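(* Let $\mathcal O$ be a $\mathcal{RIQ}$-ontology, $C$ a concept and $x$ a label. If the sequent $\emptyset\vdash x:C$ is valid relative to $\mathcal O$, then $\mathsf S(\mathcal O)\Vdash\emptyset\vdash x:\mathrm{GCI}(\mathcal O),x:C$.
   Context: Language. Fix countable pairwise disjoint sets $\mathsf{N_C}$ (concept names) and $\mathsf{N_R}$ (role names). A role is $r$ or $r^-$ with $r\in\mathsf{N_R}$; $\mathrm{Inv}(r)=r^-$, $\mathrm{Inv}(r^-)=r$; $\mathbf{R}$ is the set of roles. An RIA is $r_1\circ\cdots\circ r_n\sqsubseteq s$ with $r_i,s\in\mathbf R$; an RBox is a finite set of RIAs. It is regular iff for some strict partial order $\prec$ on $\mathsf{N_R}$ every RIA $w\sqsubseteq r$ in it has $r\in\mathsf{N_R}$ and $w$ equal to $r\circ r$, $r^-$, $s_1\circ\cdots\circ s_n$, $r\circ s_1\circ\cdots\circ s_n$, or $s_1\circ\cdots\circ s_n\circ r$ with all $s_i\prec r$. A role name $r$ is simple w.r.t. RBox $\mathcal R$ iff no RIA $w\sqsubseteq r$ is in $\mathcal R$, or for each $s\sqsubseteq r\in\mathcal R$, $s$ is a simple role name or the inverse of one; $r^-$ is simple iff $r$ is. Concepts: $C::=A\mid\neg A\mid C\sqcup C\mid C\sqcap C\mid\exists r.C\mid\forall r.C\mid{\leqslant}n\,s.C\mid{\geqslant}n\,s.C$ ($A\in\mathsf{N_C}$, $r\in\mathbf R$, $s$ simple, $n\in\mathbb N$). $\top:=A_0\sqcup\neg A_0$, $\bot:=A_0\sqcap\neg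 A_0$ for fixed $A_0$; literals are $A,\neg A$. Negation $\dot\neg$: $\dot\neg A=\neg A$, $\dot\neg\neg A=A$, De Morgan on $\sqcup,\sqcap$, $\exists/\forall$ dual, $\dot\neg({\leqslant}n\,s.C)={\geqslant}(n{+}1)\,s.C$, $\dot\neg({\geqslant}0\,s.C)=\bot$, $\dot\neg({\geqslant}n\,s.C)={\leqslant}(n{-}1)\,s.C$ ($n>0$). A TBox is a finite set of GCIs, each $\top\sqsubseteq C$; a $\mathcal{RIQ}$-ontology is $\mathcal R\cup\mathcal T$, $\mathcal R$ regular RBox, $\mathcal T$ TBox. Semantics standard ($(r^-)^{\mathcal I}$ converse of $r^{\mathcal I}$, counting quantifiers count $s$-successors in $C$); $\mathcal I\models\mathcal O$ iff all RIAs and GCIs hold. $\mathbf R$-system: for each RIA $r_1\circ\cdots\circ r_n\sqsubseteq s\in\mathcal O$ there are productions $s\to r_1\cdots r_n$ and $\mathrm{Inv}(s)\to\mathrm{Inv}(r_n)\cdots\mathrm{Inv}(r_1)$; a rewrite replaces one occurrence of a role $t$ in a string by $T$ for a production $t\to T$; $L_{\mathcal O}(r)$ is the set of strings reachable from the string $r$ by zero or more rewrites. Sequents: $\mathrm{Lab}$ is a countably infinite set of labels. Structural atoms: $r(x,y)$, $x\doteq y$, $x\not\doteq y$; labeled concepts $x:C$. $\Gamma$ forms a tree iff the directed graph on $\mathrm{Lab}(\Gamma)$ with an edge $(x,y)$ per $r(x,y)\in\Gamma$ is a directed tree. A sequent $\Gamma\vdash\Delta$: $\Gamma$ a set of structural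 atoms forming a tree, $\Delta$ a multiset of labeled concepts, $\mathrm{Lab}(\Delta)\subseteq\mathrm{Lab}(\Gamma)$ if $\Gamma\ne\emptyset$, exactly one label in $\Delta$ if $\Gamma=\emptyset$. If the TBox is $\{\top\sqsubseteq C_1,\dots,\top\sqsubseteq C_n\}$, $y:\mathrm{GCI}(\mathcal O)$ denotes $y:\dot\neg C_1,\dots,y:\dot\neg C_n$. $\neq(y_0,\dots,y_n)=\{y_i\not\doteq y_j\mid i<j\}$. $x=^*_\Gamma y$ iff $x,y$ are connected by a (possibly trivial) chain of labels of $\Gamma$ with consecutive ones related by an equality atom of $\Gamma$ in either orientation; $[x]_\Gamma$ its class. Propagation graph of $\Gamma$: vertices $[x]_\Gamma$, edges $([x]_\Gamma,r,[y]_\Gamma)$ and $([y]_\Gamma,\mathrm{Inv}(r),[x]_\Gamma)$ whenever $r(z,w)\in\Gamma$, $z\in[x]_\Gamma$, $w\in[y]_\Gamma$. $[x]_\Gamma\xrightarrow{\varepsilon}[y]_\Gamma$ iff equal; $[x]_\Gamma\xrightarrow{rS}[y]_\Gamma$ iff some edge $([x]_\Gamma,r,[z]_\Gamma)$ with $[z]_\Gamma\xrightarrow{S}[y]_\Gamma$; $[x]_\Gamma\xrightarrow{L}[y]_\Gamma$ iff this holds for some $S\in L$. Calculus $\mathsf S(\mathcal O)$ (premises / conclusion; fresh = not occurring in the conclusion): (id) none / $\Gamma\vdash x:A,x:\neg A,\Delta$. (id$_\doteq$) none / $\Gamma,x\not\doteq y\vdash\Delta$ if $x=^*y$ in the antecedent.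 ($s_\doteq$) $\Gamma\vdash x:L,y:L,\Delta$ / $\Gamma\vdash x:L,\Delta$ ($L$ literal, $x=^*_\Gamma y$). ($\sqcup$) $\Gamma\vdash x:C,x:D,\Delta$ / $\Gamma\vdash x:C\sqcup D,\Delta$. ($\sqcap$) $\Gamma\vdash x:C,\Delta$ and $\Gamma\vdash x:D,\Delta$ / $\Gamma\vdash x:C\sqcap D,\Delta$. ($\exists r$) $\Gamma\vdash x:\exists r.C,y:C,\Delta$ / $\Gamma\vdash x:\exists r.C,\Delta$ if $[x]_\Gamma\xrightarrow{L}[y]_\Gamma$, $L=L_{\mathcal O}(r)$. ($\forall r$) $\Gamma,r(x,y)\vdash y:C,y:\mathrm{GCI}(\mathcal O),\Delta$ / $\Gamma\vdash x:\forall r.C,\Delta$, $y$ fresh. (${\leqslant}n\,r$) $\Gamma,\neq(y_0,\dots,y_n),r(x,y_0),\dots,r(x,y_n)\vdash y_0:\dot\neg C,y_0:\mathrm{GCI}(\mathcal O),\dots,y_n:\dot\neg C,y_n:\mathrm{GCI}(\mathcal O),\Delta$ / $\Gamma\vdash x:{\leqslant}n\,r.C,\Delta$, $y_i$ fresh. (${\geqslant}n\,r$) $\Gamma\vdash y_i:C,x:{\geqslant}n\,r.C,\Delta$ ($1\le i\le n$) and $\Gamma,y_i\doteq y_j\vdash x:{\geqslant}n\,r.C,\Delta$ ($1\le i<j\le n$) / $\Gamma\vdash x:{\geqslant}n\,r.C,\Delta$ if $[x]_\Gamma\xrightarrow{L}[y_i]_\Gamma$, $L=L_{\mathcal O}(r)$,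 for all $i$. A proof is a finite tree of rule instances; $\mathsf S(\mathcal O)\Vdash S$ means $S$ has a proof. Validity: $\emptyset\vdash x:C$ is valid relative to $\mathcal O$ iff for every interpretation $\mathcal I\models\mathcal O$ and every $\lambda(x)\in\Delta^{\mathcal I}$ we have $\lambda(x)\in C^{\mathcal I}$ (in general, a sequent $\Gamma\vdash\Delta$ is valid relative to $\mathcal O$ iff for every model $\mathcal I$ of $\mathcal O$ and assignment $\lambda$ of domain elements to labels satisfying all atoms of $\Gamma$, some $x:C\in\Delta$ has $\lambda(x)\in C^{\mathcal I}$). *)

theory Defs
  imports
    "HOL-Library.Multiset"
    "HOL-Library.Countable"
    "HOL-Library.Infinite_Typeclass"
begin

subsection \<open>Roles, role boxes and concepts\<close>

datatype 'r role = Name 'r | Inverse 'r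

fun inv_role :: "'r role \<Rightarrow> 'r role" where
  "inv_role (Name r) = Inverse r"
| "inv_role (Inverse r) = Name r"

fun role_name :: "'r role \<Rightarrow> 'r" where
  "role_name (Name r) = r"
| "role_name (Inverse r) = r"

text \<open>The pair \<open>([r\<^sub>1, \<dots>, r\<^sub>n], s)\<close> stands for the inclusion \<open>r\<^sub>1 \<circ> \<dots> \<circ> r\<^sub>n \<sqsubseteq> s\<close>.\<close>

type_synonym 'r ria = "'r role list \<times> 'r role"

definition is_rbox :: "'r ria set \<Rightarrow> bool" where
  "is_rbox R \<longleftrightarrow> finite R \<and> (\<forall>(w, s) \<in> R. w \<noteq> [])"

text \<open>The order is on role names; an inverse role is compared through its role name.\<close>

definition regular :: "'r ria set \<Rightarrow> bool" where
  "regular R \<longleftrightarrow>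
     (\<exists>prec :: 'r \<Rightarrow> 'r \<Rightarrow> bool. irreflp prec \<and> transp prec \<and>
       (\<forall>(w, t) \<in> R. \<exists>r. t = Name r \<and>
          (w = [Name r, Name r] \<or>
           w = [Inverse r] \<or>
           (\<exists>v. v \<noteq> [] \<and> (\<forall>s \<in> set v. prec (role_name s) r) \<and>
              (w = v \<or> w = Name r # v \<or> w = v @ [Name r])))))"

inductive simple_name :: "'r ria set \<Rightarrow> 'r \<Rightarrow> bool" for R where
  undefined_name: "(\<And>w. (w, Name r) \<notin> R) \<Longrightarrow> simple_name R r"
| defined_name:
    "(\<And>w. (w, Name r) \<in> R \<Longrightarrow>
        \<exists>s. simple_name R s \<and> (w = [Name s] \<or> w = [Inverse s])) \<Longrightarrow>
     simple_name R r"

definition simple :: "'r ria set \<Rightarrow> 'r role \<Rightarrow> bool" where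
  "simple R r \<longleftrightarrow> simple_name R (role_name r)"

datatype ('c, 'r) concept =
    Atom 'c
  | NegAtom 'c
  | Or "('c, 'r) concept" "('c, 'r) concept"
  | And "('c, 'r) concept" "('c, 'r) concept"
  | Ex "'r role" "('c, 'r) concept"
  | All "'r role" "('c, 'r) concept"
  | AtMost nat "'r role" "('c, 'r) concept"
  | AtLeast nat "'r role" "('c, 'r) concept"

text \<open>The datatype imposes no restriction on the roles in counting quantifiers; the following
  predicate singles out the concepts of the language.\<close>

fun is_concept :: "'r ria set \<Rightarrow> ('c, 'r) concept \<Rightarrow> bool" where
  "is_concept R (Atom A) = True"
| "is_concept R (NegAtom A) = True"
| "is_concept R (Or C D) = (is_concept R C \<and> is_concept R D)"
| "is_concept R (And C D) = (is_concept R C \<and> is_concept R D)"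
| "is_concept R (Ex r C) = is_concept R C"
| "is_concept R (All r C) = is_concept R C"
| "is_concept R (AtMost n s C) = (simple R s \<and> is_concept R C)"
| "is_concept R (AtLeast n s C) = (simple R s \<and> is_concept R C)"

definition literal :: "('c, 'r) concept \<Rightarrow> bool" where
  "literal L \<longleftrightarrow> (\<exists>A. L = Atom A \<or> L = NegAtom A)"

definition top_concept :: "'c \<Rightarrow> ('c, 'r) concept" where
  "top_concept A\<^sub>0 = Or (Atom A\<^sub>0) (NegAtom A\<^sub>0)"

definition bot_concept :: "'c \<Rightarrow> ('c, 'r) concept" where
  "bot_concept A\<^sub>0 = And (Atom A\<^sub>0) (NegAtom A\<^sub>0)"

text \<open>The parameter \<open>A\<^sub>0\<close> is the concept name fixed to define the top and bottom concepts.\<close>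

fun dneg :: "'c \<Rightarrow> ('c, 'r) concept \<Rightarrow> ('c, 'r) concept" where
  "dneg A\<^sub>0 (Atom A) = NegAtom A"
| "dneg A\<^sub>0 (NegAtom A) = Atom A"
| "dneg A\<^sub>0 (Or C D) = And (dneg A\<^sub>0 C) (dneg A\<^sub>0 D)"
| "dneg A\<^sub>0 (And C D) = Or (dneg A\<^sub>0 C) (dneg A\<^sub>0 D)"
| "dneg A\<^sub>0 (Ex r C) = All r (dneg A\<^sub>0 C)"
| "dneg A\<^sub>0 (All r C) = Ex r (dneg A\<^sub>0 C)"
| "dneg A\<^sub>0 (AtMost n s C) = AtLeast (Suc n) s C"
| "dneg A\<^sub>0 (AtLeast 0 s C) = bot_concept A\<^sub>0"
| "dneg A\<^sub>0 (AtLeast (Suc n) s C) = AtMost n s C"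

text \<open>Since every general concept inclusion has the form \<open>\<top> \<sqsubseteq> C\<close>, a TBox is represented by the
  set of its right-hand sides \<open>C\<close>.\<close>

record ('c, 'r) ontology =
  rbox :: "'r ria set"
  tbox :: "('c, 'r) concept set"

definition riq_ontology :: "('c, 'r) ontology \<Rightarrow> bool" where
  "riq_ontology Ont \<longleftrightarrow>
     is_rbox (rbox Ont) \<and> regular (rbox Ont) \<and>
     finite (tbox Ont) \<and> (\<forall>C \<in> tbox Ont. is_concept (rbox Ont) C)"

subsection \<open>Semantics of concepts and ontologies\<close>

record ('c, 'r, 'd) interp =
  domain :: "'d set"
  concept_int :: "'c \<Rightarrow> 'd set"
  name_int :: "'r \<Rightarrow> ('d \<times> 'd) set"

definition is_interp :: "('c, 'r, 'd) interp \<Rightarrow> bool" where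
  "is_interp I \<longleftrightarrow>
     domain I \<noteq> {} \<and>
     (\<forall>A. concept_int I A \<subseteq> domain I) \<and>
     (\<forall>r. name_int I r \<subseteq> domain I \<times> domain I)"

fun role_int :: "('c, 'r, 'd) interp \<Rightarrow> 'r role \<Rightarrow> ('d \<times> 'd) set" where
  "role_int I (Name r) = name_int I r"
| "role_int I (Inverse r) = (name_int I r)\<inverse>"

definition string_int :: "('c, 'r, 'd) interp \<Rightarrow> 'r role list \<Rightarrow> ('d \<times> 'd) set" where
  "string_int I w = foldr (\<lambda>r X. role_int I r O X) w (Id_on (domain I))"

text \<open>\<^const>\<open>card\<close> is \<open>0\<close> on infinite sets, so infinite sets of successors are treated separately.\<close>

fun sem :: "('c, 'r, 'd) interp \<Rightarrow> ('c, 'r) concept \<Rightarrow> 'd set" where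
  "sem I (Atom A) = concept_int I A"
| "sem I (NegAtom A) = domain I - concept_int I A"
| "sem I (Or C D) = sem I C \<union> sem I D"
| "sem I (And C D) = sem I C \<inter> sem I D"
| "sem I (Ex r C) = {d \<in> domain I. \<exists>e. (d, e) \<in> role_int I r \<and> e \<in> sem I C}"
| "sem I (All r C) = {d \<in> domain I. \<forall>e. (d, e) \<in> role_int I r \<longrightarrow> e \<in> sem I C}"
| "sem I (AtMost n s C) =
     {d \<in> domain I. finite {e. (d, e) \<in> role_int I s \<and> e \<in> sem I C} \<and>
                    card {e. (d, e) \<in> role_int I s \<and> e \<in> sem I C} \<le> n}"
| "sem I (AtLeast n s C) =
     {d \<in> domain I. infinite {e. (d, e) \<in> role_int I s \<and> e \<in> sem I C} \<or>
                    n \<le> card {e. (d, e) \<in> role_int I s \<and> e \<in> sem I C}}"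

definition models :: "'c \<Rightarrow> ('c, 'r, 'd) interp \<Rightarrow> ('c, 'r) ontology \<Rightarrow> bool" where
  "models A\<^sub>0 I Ont \<longleftrightarrow>
     (\<forall>(w, s) \<in> rbox Ont. string_int I w \<subseteq> role_int I s) \<and>
     (\<forall>C \<in> tbox Ont. sem I (top_concept A\<^sub>0) \<subseteq> sem I C)"

subsection \<open>The rewriting system of an ontology\<close>

definition productions :: "'r ria set \<Rightarrow> ('r role \<times> 'r role list) set" where
  "productions R =
     {(s, w) | w s. (w, s) \<in> R} \<union>
     {(inv_role s, rev (map inv_role w)) | w s. (w, s) \<in> R}"

definition rewrite :: "'r ria set \<Rightarrow> 'r role list \<Rightarrow> 'r role list \<Rightarrow> bool" where
  "rewrite R S S' \<longleftrightarrow>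
     (\<exists>u t v T. (t, T) \<in> productions R \<and> S = u @ [t] @ v \<and> S' = u @ T @ v)"

definition role_lang :: "('c, 'r) ontology \<Rightarrow> 'r role \<Rightarrow> 'r role list set" where
  "role_lang Ont r = {S. (rewrite (rbox Ont))\<^sup>*\<^sup>* [r] S}"

subsection \<open>Sequents\<close>

datatype ('r, 'l) atom =
    RoleAt "'r role" 'l 'l
  | EqAt 'l 'l
  | NeqAt 'l 'l

fun atom_labels :: "('r, 'l) atom \<Rightarrow> 'l set" where
  "atom_labels (RoleAt r x y) = {x, y}"
| "atom_labels (EqAt x y) = {x, y}"
| "atom_labels (NeqAt x y) = {x, y}"

definition ant_labels :: "('r, 'l) atom set \<Rightarrow> 'l set" where
  "ant_labels \<Gamma> = (\<Union>a \<in> \<Gamma>. atom_labels a)"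

text \<open>The labeled concept \<open>x : C\<close> is the pair \<open>(x, C)\<close>.\<close>

type_synonym ('c, 'r, 'l) succedent = "('l \<times> ('c, 'r) concept) multiset"

definition suc_labels :: "('c, 'r, 'l) succedent \<Rightarrow> 'l set" where
  "suc_labels \<Delta> = fst ` set_mset \<Delta>"

definition directed_tree :: "'l set \<Rightarrow> ('l \<times> 'l) set \<Rightarrow> bool" where
  "directed_tree V E \<longleftrightarrow>
     E \<subseteq> V \<times> V \<and>
     (\<exists>root \<in> V.
        (\<forall>u. (u, root) \<notin> E) \<and>
        (\<forall>v \<in> V - {root}. \<exists>!u. (u, v) \<in> E) \<and>
        (\<forall>v \<in> V. (root, v) \<in> E\<^sup>*))"

definition forms_tree :: "('r, 'l) atom set \<Rightarrow> bool" where
  "forms_tree \<Gamma> \<longleftrightarrow> directed_tree (ant_labels \<Gamma>) {(x, y). \<exists>r. RoleAt r x y \<in> \<Gamma>}"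

datatype ('c, 'r, 'l) sequent =
  Sequent (ant: "('r, 'l) atom set") (suc: "('c, 'r, 'l) succedent")  (infix "\<turnstile>" 50)

definition seq_labels :: "('c, 'r, 'l) sequent \<Rightarrow> 'l set" where
  "seq_labels S = ant_labels (ant S) \<union> suc_labels (suc S)"

definition is_sequent :: "('c, 'r) ontology \<Rightarrow> ('c, 'r, 'l) sequent \<Rightarrow> bool" where
  "is_sequent Ont S \<longleftrightarrow>
     (\<forall>(x, C) \<in># suc S. is_concept (rbox Ont) C) \<and>
     (if ant S = {} then \<exists>x. suc_labels (suc S) = {x}
      else forms_tree (ant S) \<and> suc_labels (suc S) \<subseteq> ant_labels (ant S))"

text \<open>Multiplicities are kept: distinct concepts of the TBox may have the same negation.\<close>

definition gci :: "'c \<Rightarrow> ('c, 'r) ontology \<Rightarrow> 'l \<Rightarrow> ('c, 'r, 'l) succedent" where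
  "gci A\<^sub>0 Ont y = image_mset (\<lambda>C. (y, dneg A\<^sub>0 C)) (mset_set (tbox Ont))"

text \<open>Reflexive on all labels, so that \<open>x =\<^sup>* x\<close> also for the label of a sequent with empty
  antecedent.\<close>

definition eq_closure :: "('r, 'l) atom set \<Rightarrow> ('l \<times> 'l) set" where
  "eq_closure \<Gamma> = {(x, y). EqAt x y \<in> \<Gamma> \<or> EqAt y x \<in> \<Gamma>}\<^sup>*"

definition eq_class :: "('r, 'l) atom set \<Rightarrow> 'l \<Rightarrow> 'l set" where
  "eq_class \<Gamma> x = {y. (x, y) \<in> eq_closure \<Gamma>}"

definition prop_edges :: "('r, 'l) atom set \<Rightarrow> ('l set \<times> 'r role \<times> 'l set) set" where
  "prop_edges \<Gamma> =
     {(eq_class \<Gamma> x, r, eq_class \<Gamma> y) | x r y.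
        \<exists>z w. RoleAt r z w \<in> \<Gamma> \<and> z \<in> eq_class \<Gamma> x \<and> w \<in> eq_class \<Gamma> y} \<union>
     {(eq_class \<Gamma> y, inv_role r, eq_class \<Gamma> x) | x r y.
        \<exists>z w. RoleAt r z w \<in> \<Gamma> \<and> z \<in> eq_class \<Gamma> x \<and> w \<in> eq_class \<Gamma> y}"

fun prop_path :: "('r, 'l) atom set \<Rightarrow> 'l set \<Rightarrow> 'r role list \<Rightarrow> 'l set \<Rightarrow> bool" where
  "prop_path \<Gamma> X [] Y = (X = Y)"
| "prop_path \<Gamma> X (r # S) Y = (\<exists>Z. (X, r, Z) \<in> prop_edges \<Gamma> \<and> prop_path \<Gamma> Z S Y)"

definition reaches :: "('r, 'l) atom set \<Rightarrow> 'l \<Rightarrow> 'r role list set \<Rightarrow> 'l \<Rightarrow> bool" where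
  "reaches \<Gamma> x L y \<longleftrightarrow> (\<exists>S \<in> L. prop_path \<Gamma> (eq_class \<Gamma> x) S (eq_class \<Gamma> y))"

definition all_distinct :: "'l list \<Rightarrow> ('r, 'l) atom set" where
  "all_distinct ys = {NeqAt (ys ! i) (ys ! j) | i j. i < j \<and> j < length ys}"

subsection \<open>Validity\<close>

fun sat_atom :: "('c, 'r, 'd) interp \<Rightarrow> ('l \<Rightarrow> 'd) \<Rightarrow> ('r, 'l) atom \<Rightarrow> bool" where
  "sat_atom I f (RoleAt r x y) = ((f x, f y) \<in> role_int I r)"
| "sat_atom I f (EqAt x y) = (f x = f y)"
| "sat_atom I f (NeqAt x y) = (f x \<noteq> f y)"

text \<open>HOL cannot quantify over all types inside a formula: the domains range over all nonempty
  subsets of the type \<open>'d\<close>.\<close>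

definition valid ::
  "'d itself \<Rightarrow> 'c \<Rightarrow> ('c, 'r) ontology \<Rightarrow> ('c, 'r, 'l) sequent \<Rightarrow> bool" where
  "valid _ A\<^sub>0 Ont S \<longleftrightarrow>
     (\<forall>(I :: ('c, 'r, 'd) interp) (f :: 'l \<Rightarrow> 'd).
        is_interp I \<and> models A\<^sub>0 I Ont \<and> range f \<subseteq> domain I \<and>
        (\<forall>a \<in> ant S. sat_atom I f a) \<longrightarrow>
        (\<exists>(x, C) \<in># suc S. f x \<in> sem I C))"

subsection \<open>The sequent calculus\<close>

text \<open>Every rule requires its conclusion to be a sequent; the premises, being provable, then are
  sequents as well. In \<open>at_most\<close> the fresh labels \<open>y\<^sub>0, \<dots>, y\<^sub>n\<close> are pairwise distinct, and
  \<open>at_least\<close> with \<open>n = 0\<close> has no premises.\<close>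

inductive provable :: "'c \<Rightarrow> ('c, 'r) ontology \<Rightarrow> ('c, 'r, 'l) sequent \<Rightarrow> bool"
  for A\<^sub>0 :: 'c and Ont :: "('c, 'r) ontology" where
  id:
    "is_sequent Ont (\<Gamma> \<turnstile> {#(x, Atom A), (x, NegAtom A)#} + \<Delta>) \<Longrightarrow>
     provable A\<^sub>0 Ont (\<Gamma> \<turnstile> {#(x, Atom A), (x, NegAtom A)#} + \<Delta>)"
| id_eq:
    "is_sequent Ont (insert (NeqAt x y) \<Gamma> \<turnstile> \<Delta>) \<Longrightarrow>
     (x, y) \<in> eq_closure (insert (NeqAt x y) \<Gamma>) \<Longrightarrow>
     provable A\<^sub>0 Ont (insert (NeqAt x y) \<Gamma> \<turnstile> \<Delta>)"
| subst_eq: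
    "is_sequent Ont (\<Gamma> \<turnstile> {#(x, L)#} + \<Delta>) \<Longrightarrow>
     literal L \<Longrightarrow>
     (x, y) \<in> eq_closure \<Gamma> \<Longrightarrow>
     provable A\<^sub>0 Ont (\<Gamma> \<turnstile> {#(x, L), (y, L)#} + \<Delta>) \<Longrightarrow>
     provable A\<^sub>0 Ont (\<Gamma> \<turnstile> {#(x, L)#} + \<Delta>)"
| disj:
    "is_sequent Ont (\<Gamma> \<turnstile> {#(x, Or C D)#} + \<Delta>) \<Longrightarrow>
     provable A\<^sub>0 Ont (\<Gamma> \<turnstile> {#(x, C), (x, D)#} + \<Delta>) \<Longrightarrow>
     provable A\<^sub>0 Ont (\<Gamma> \<turnstile> {#(x, Or C D)#} + \<Delta>)"
| conj:
    "is_sequent Ont (\<Gamma> \<turnstile> {#(x, And C D)#} + \<Delta>) \<Longrightarrow>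
     provable A\<^sub>0 Ont (\<Gamma> \<turnstile> {#(x, C)#} + \<Delta>) \<Longrightarrow>
     provable A\<^sub>0 Ont (\<Gamma> \<turnstile> {#(x, D)#} + \<Delta>) \<Longrightarrow>
     provable A\<^sub>0 Ont (\<Gamma> \<turnstile> {#(x, And C D)#} + \<Delta>)"
| exist:
    "is_sequent Ont (\<Gamma> \<turnstile> {#(x, Ex r C)#} + \<Delta>) \<Longrightarrow>
     reaches \<Gamma> x (role_lang Ont r) y \<Longrightarrow>
     provable A\<^sub>0 Ont (\<Gamma> \<turnstile> {#(x, Ex r C), (y, C)#} + \<Delta>) \<Longrightarrow>
     provable A\<^sub>0 Ont (\<Gamma> \<turnstile> {#(x, Ex r C)#} + \<Delta>)"
| univ:
    "is_sequent Ont (\<Gamma> \<turnstile> {#(x, All r C)#} + \<Delta>) \<Longrightarrow>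
     y \<notin> seq_labels (\<Gamma> \<turnstile> {#(x, All r C)#} + \<Delta>) \<Longrightarrow>
     provable A\<^sub>0 Ont (insert (RoleAt r x y) \<Gamma> \<turnstile> {#(y, C)#} + gci A\<^sub>0 Ont y + \<Delta>) \<Longrightarrow>
     provable A\<^sub>0 Ont (\<Gamma> \<turnstile> {#(x, All r C)#} + \<Delta>)"
| at_most:
    "is_sequent Ont (\<Gamma> \<turnstile> {#(x, AtMost n r C)#} + \<Delta>) \<Longrightarrow>
     length ys = Suc n \<Longrightarrow>
     distinct ys \<Longrightarrow>
     set ys \<inter> seq_labels (\<Gamma> \<turnstile> {#(x, AtMost n r C)#} + \<Delta>) = {} \<Longrightarrow>
     provable A\<^sub>0 Ont
       (\<Gamma> \<union> all_distinct ys \<union> RoleAt r x ` set ys \<turnstile>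
        (\<Sum>y \<in># mset ys. {#(y, dneg A\<^sub>0 C)#} + gci A\<^sub>0 Ont y) + \<Delta>) \<Longrightarrow>
     provable A\<^sub>0 Ont (\<Gamma> \<turnstile> {#(x, AtMost n r C)#} + \<Delta>)"
| at_least:
    "is_sequent Ont (\<Gamma> \<turnstile> {#(x, AtLeast n r C)#} + \<Delta>) \<Longrightarrow>
     length ys = n \<Longrightarrow>
     (\<And>y. y \<in> set ys \<Longrightarrow> reaches \<Gamma> x (role_lang Ont r) y) \<Longrightarrow>
     (\<And>y. y \<in> set ys \<Longrightarrow>
        provable A\<^sub>0 Ont (\<Gamma> \<turnstile> {#(y, C), (x, AtLeast n r C)#} + \<Delta>)) \<Longrightarrow>
     (\<And>i j. i < j \<Longrightarrow> j < n \<Longrightarrow>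
        provable A\<^sub>0 Ont (insert (EqAt (ys ! i) (ys ! j)) \<Gamma> \<turnstile> {#(x, AtLeast n r C)#} + \<Delta>)) \<Longrightarrow>
     provable A\<^sub>0 Ont (\<Gamma> \<turnstile> {#(x, AtLeast n r C)#} + \<Delta>)"

end

theory Submission
  imports Defs
begin

text \<open>Completeness by a countermodel. An unprovable sequent always has an unprovable premise under
  every applicable rule, so a fair enumeration of rule instances turns an unprovable end sequent
  into an infinite sequence of unprovable sequents. Its union is a saturated set whose labels,
  modulo the equality atoms, form an interpretation: a pair is in \<open>r\<close> iff the propagation graph
  connects it by a string of the language of \<open>r\<close>. The language absorbs all role inclusions,
  and every labeled concept of the union is false at its label.\<close>

text \<open>The rules fall into two kinds. Those for \<open>Or\<close>, \<open>And\<close>,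
  \<open>All\<close> and \<open>AtMost\<close> delete their principal formula. Those for literals,
  \<open>Ex\<close> and \<open>AtLeast\<close> keep it, but one application serves only one label or
  one list of labels, while new labels and new connections keep appearing. Hence a formula is either
  decomposed at some stage or persists forever, and in the second case it must be revisited for
  every list of labels at arbitrarily late stages. This succeeds because the side conditions are
  finitary: a walk through the limit antecedent uses finitely many atoms, so it exists at a finite
  stage and remains from then on. Countability of names and labels makes the tasks enumerable.

  The end sequent carries the TBox negations at its label, and every fresh label receives them too;
  falsifying them everywhere makes the TBox true in the countermodel. Since the domain has to lie in
  the given type \<open>'d\<close>, the quotient of the labels is replaced by a map \<open>h\<close>
  that identifies exactly the labels equated in the limit.\<close>

instance role :: (countable) countable by countable_datatype
instance concept :: (countable, countable) countable by countable_datatype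

subsection \<open>Propagation paths on labels\<close>

definition role_edges :: "('r, 'l) atom set \<Rightarrow> 'r role \<Rightarrow> ('l \<times> 'l) set" where
  "role_edges \<Gamma> r = {(z, w). RoleAt r z w \<in> \<Gamma> \<or> RoleAt (inv_role r) w z \<in> \<Gamma>}"

text \<open>Unlike \<^const>\<open>prop_path\<close>, whose vertices are classes depending on \<open>\<Gamma>\<close>, this relation is
  monotone in \<open>\<Gamma>\<close> in an evident way.\<close>

fun walk :: "('r, 'l) atom set \<Rightarrow> 'r role list \<Rightarrow> ('l \<times> 'l) set" where
  "walk \<Gamma> [] = eq_closure \<Gamma>"
| "walk \<Gamma> (r # S) = eq_closure \<Gamma> O role_edges \<Gamma> r O walk \<Gamma> S"

lemma inv_role_inv_role [simp]: "inv_role (inv_role r) = r"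
  by (cases r) auto

lemma eq_closure_refl [simp]: "(x, x) \<in> eq_closure \<Gamma>"
  by (simp add: eq_closure_def)

lemma eq_closure_sym: "(x, y) \<in> eq_closure \<Gamma> \<Longrightarrow> (y, x) \<in> eq_closure \<Gamma>"
  unfolding eq_closure_def by (rule symD[OF sym_rtrancl]) (auto simp: sym_def)

lemma eq_closure_trans:
  "(x, y) \<in> eq_closure \<Gamma> \<Longrightarrow> (y, z) \<in> eq_closure \<Gamma> \<Longrightarrow> (x, z) \<in> eq_closure \<Gamma>"
  unfolding eq_closure_def by (rule rtrancl_trans)

lemma eq_closure_mono: "\<Gamma> \<subseteq> \<Gamma>' \<Longrightarrow> eq_closure \<Gamma> \<subseteq> eq_closure \<Gamma>'"
  unfolding eq_closure_def by (rule rtrancl_mono) auto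

lemma eq_class_eq_iff: "eq_class \<Gamma> x = eq_class \<Gamma> y \<longleftrightarrow> (x, y) \<in> eq_closure \<Gamma>"
proof
  assume "eq_class \<Gamma> x = eq_class \<Gamma> y"
  then have "y \<in> eq_class \<Gamma> x" by (simp add: eq_class_def)
  then show "(x, y) \<in> eq_closure \<Gamma>" by (simp add: eq_class_def)
next
  assume "(x, y) \<in> eq_closure \<Gamma>"
  then show "eq_class \<Gamma> x = eq_class \<Gamma> y"
    unfolding eq_class_def by (metis eq_closure_sym eq_closure_trans)
qed

text \<open>A walk begins with a free move inside a class, and two such moves compose to one.
  Therefore walks can be concatenated, and their endpoints exchanged for equal labels.\<close>

lemma eq_closure_O_walk: "eq_closure \<Gamma> O walk \<Gamma> S = walk \<Gamma> S"
proof -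
  have "eq_closure \<Gamma> O eq_closure \<Gamma> = eq_closure \<Gamma>"
    using eq_closure_trans eq_closure_refl by fast
  then show ?thesis
    by (cases S) (simp_all add: O_assoc[symmetric])
qed

lemma prop_edges_iff:
  "(eq_class \<Gamma> x, r, Z) \<in> prop_edges \<Gamma> \<longleftrightarrow>
     (\<exists>z w. (x, z) \<in> eq_closure \<Gamma> \<and> (z, w) \<in> role_edges \<Gamma> r \<and> Z = eq_class \<Gamma> w)"
    (is "?L \<longleftrightarrow> ?R")
proof
  assume ?L
  then consider
      x' y z w where "eq_class \<Gamma> x = eq_class \<Gamma> x'" "Z = eq_class \<Gamma> y" "RoleAt r z w \<in> \<Gamma>"
        "z \<in> eq_class \<Gamma> x'" "w \<in> eq_class \<Gamma> y"
    | x' y s z w where "eq_class \<Gamma> x = eq_class \<Gamma> y" "Z = eq_class \<Gamma> x'" "r = inv_role s"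
        "RoleAt s z w \<in> \<Gamma>" "z \<in> eq_class \<Gamma> x'" "w \<in> eq_class \<Gamma> y"
    unfolding prop_edges_def by blast
  then show ?R
  proof cases
    case 1
    then have "(x, x') \<in> eq_closure \<Gamma>" "(x', z) \<in> eq_closure \<Gamma>" "Z = eq_class \<Gamma> w"
      by (simp_all add: eq_class_eq_iff) (simp_all add: eq_class_def)
    moreover have "(z, w) \<in> role_edges \<Gamma> r"
      using 1 by (simp add: role_edges_def)
    ultimately show ?thesis using eq_closure_trans[of x x' \<Gamma> z] by auto
  next
    case 2
    then have "(x, y) \<in> eq_closure \<Gamma>" "(y, w) \<in> eq_closure \<Gamma>" "Z = eq_class \<Gamma> z"
      by (simp_all add: eq_class_eq_iff) (simp_all add: eq_class_def)
    moreover have "(w, z) \<in> role_edges \<Gamma> r"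
      using 2 by (simp add: role_edges_def)
    ultimately show ?thesis using eq_closure_trans[of x y \<Gamma> w] by auto
  qed
next
  assume ?R
  then obtain z w where zw: "(x, z) \<in> eq_closure \<Gamma>" "(z, w) \<in> role_edges \<Gamma> r"
    and Z: "Z = eq_class \<Gamma> w" by blast
  have mem: "z \<in> eq_class \<Gamma> x" "w \<in> eq_class \<Gamma> w"
    using zw by (auto simp: eq_class_def)
  from zw(2) consider "RoleAt r z w \<in> \<Gamma>" | "RoleAt (inv_role r) w z \<in> \<Gamma>"
    by (auto simp: role_edges_def)
  then show ?L
  proof cases
    case 1
    then have "(eq_class \<Gamma> x, r, eq_class \<Gamma> w) \<in> prop_edges \<Gamma>"
      unfolding prop_edges_def using mem by blast
    then show ?thesis by (simp add: Z)
  next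
    case 2
    then have "(eq_class \<Gamma> x, inv_role (inv_role r), eq_class \<Gamma> w) \<in> prop_edges \<Gamma>"
      unfolding prop_edges_def using mem by blast
    then show ?thesis by (simp add: Z)
  qed
qed

text \<open>The induction goes through because every vertex reached from the class of a label is
  again the class of a label. Side conditions can thus be handled on labels.\<close>

lemma prop_path_iff:
  "prop_path \<Gamma> (eq_class \<Gamma> x) S (eq_class \<Gamma> y) \<longleftrightarrow> (x, y) \<in> walk \<Gamma> S"
proof (induction S arbitrary: x)
  case Nil
  then show ?case by (simp add: eq_class_eq_iff)
next
  case (Cons r S)
  show ?case
    by (simp add: prop_edges_iff) (use Cons.IH in blast)
qed

lemma reaches_iff: "reaches \<Gamma> x L y \<longleftrightarrow> (\<exists>S \<in> L. (x, y) \<in> walk \<Gamma> S)"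
  by (simp add: reaches_def prop_path_iff)

lemma walk_append: "walk \<Gamma> (S @ T) = walk \<Gamma> S O walk \<Gamma> T"
  by (induction S) (simp_all add: eq_closure_O_walk O_assoc)

lemma walk_O_eq_closure: "walk \<Gamma> S O eq_closure \<Gamma> = walk \<Gamma> S"
  using walk_append[of \<Gamma> S "[]"] by simp

lemma walk_inverse: "(x, y) \<in> walk \<Gamma> S \<Longrightarrow> (y, x) \<in> walk \<Gamma> (rev (map inv_role S))"
proof (induction S arbitrary: x)
  case Nil
  then show ?case by (simp add: eq_closure_sym)
next
  case (Cons r S)
  then obtain z w where "(x, z) \<in> eq_closure \<Gamma>" "(z, w) \<in> role_edges \<Gamma> r" "(w, y) \<in> walk \<Gamma> S"
    by auto
  moreover from this have "(w, z) \<in> role_edges \<Gamma> (inv_role r)"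
    by (auto simp: role_edges_def)
  ultimately have "(w, x) \<in> walk \<Gamma> [inv_role r]" "(y, w) \<in> walk \<Gamma> (rev (map inv_role S))"
    using Cons.IH eq_closure_sym[of x z \<Gamma>] eq_closure_refl[of w \<Gamma>] by (simp_all, blast)
  then show ?case by (auto simp: walk_append)
qed

lemma walk_mono: "\<Gamma> \<subseteq> \<Gamma>' \<Longrightarrow> walk \<Gamma> S \<subseteq> walk \<Gamma>' S"
proof (induction S)
  case Nil
  then show ?case by (simp add: eq_closure_mono)
next
  case (Cons r S)
  moreover have "role_edges \<Gamma> r \<subseteq> role_edges \<Gamma>' r"
    using Cons.prems by (auto simp: role_edges_def)
  ultimately show ?case
    by (simp add: eq_closure_mono relcomp_mono)
qed

lemma reaches_mono: "\<Gamma> \<subseteq> \<Gamma>' \<Longrightarrow> reaches \<Gamma> x L y \<Longrightarrow> reaches \<Gamma>' x L y"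
  unfolding reaches_iff using walk_mono by blast

text \<open>The \<open>insert x\<close> accounts for the trivial chain: with an empty antecedent the
  single label of the sequent is not in \<open>ant_labels \<Gamma>\<close>.\<close>

lemma eq_closure_labels: "(x, y) \<in> eq_closure \<Gamma> \<Longrightarrow> y \<in> insert x (ant_labels \<Gamma>)"
  unfolding eq_closure_def
proof (induction rule: rtrancl_induct)
  case (step y z)
  then have "EqAt y z \<in> \<Gamma> \<or> EqAt z y \<in> \<Gamma>" by simp
  then have "z \<in> ant_labels \<Gamma>"
    unfolding ant_labels_def by (auto intro: bexI[of _ "EqAt y z"] bexI[of _ "EqAt z y"])
  then show ?case by simp
qed simp

lemma walk_labels: "(x, y) \<in> walk \<Gamma> S \<Longrightarrow> y \<in> insert x (ant_labels \<Gamma>)"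
proof (induction S arbitrary: x)
  case Nil
  then show ?case using eq_closure_labels[of x y \<Gamma>] by simp
next
  case (Cons r S)
  then obtain z w where zw: "(z, w) \<in> role_edges \<Gamma> r" "(w, y) \<in> walk \<Gamma> S"
    by auto
  then have "w \<in> ant_labels \<Gamma>"
    by (force simp: role_edges_def ant_labels_def)
  then show ?case using Cons.IH zw by blast
qed

lemma reaches_labels: "reaches \<Gamma> x L y \<Longrightarrow> y \<in> insert x (ant_labels \<Gamma>)"
  unfolding reaches_iff by (elim bexE) (rule walk_labels)

text \<open>Compactness: a chain of equalities is finite, so all its atoms are present at the latest
  of finitely many stages.\<close>

lemma chain_eq_closure:
  assumes "incseq \<Gamma>" "(x, y) \<in> eq_closure (\<Union>n. \<Gamma> n)"
  shows "\<exists>n. (x, y) \<in> eq_closure (\<Gamma> n)"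
  using assms(2) unfolding eq_closure_def
proof (induction rule: rtrancl_induct)
  case base
  then show ?case by blast
next
  case (step y z)
  then obtain n m where n: "(x, y) \<in> eq_closure (\<Gamma> n)"
    and m: "EqAt y z \<in> \<Gamma> m \<or> EqAt z y \<in> \<Gamma> m"
    by (auto simp: eq_closure_def)
  have "(x, y) \<in> eq_closure (\<Gamma> (max n m))"
    using n eq_closure_mono[OF incseqD[OF assms(1), of n "max n m"]] by auto
  moreover have "(y, z) \<in> eq_closure (\<Gamma> (max n m))"
    using m incseqD[OF assms(1), of m "max n m"] by (auto simp: eq_closure_def)
  ultimately show ?case
    unfolding eq_closure_def by (meson rtrancl_trans)
qed

lemma chain_walk:
  assumes "incseq \<Gamma>" "(x, y) \<in> walk (\<Union>n. \<Gamma> n) S"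
  shows "\<exists>n. (x, y) \<in> walk (\<Gamma> n) S"
  using assms(2)
proof (induction S arbitrary: x)
  case Nil
  then show ?case using chain_eq_closure[OF assms(1)] by simp
next
  case (Cons r S)
  then obtain z w where z: "(x, z) \<in> eq_closure (\<Union>n. \<Gamma> n)"
    and zw: "(z, w) \<in> role_edges (\<Union>n. \<Gamma> n) r" and w: "(w, y) \<in> walk (\<Union>n. \<Gamma> n) S"
    by auto
  obtain i where i: "(x, z) \<in> eq_closure (\<Gamma> i)"
    using chain_eq_closure[OF assms(1) z] by blast
  obtain j where j: "(z, w) \<in> role_edges (\<Gamma> j) r"
    using zw by (auto simp: role_edges_def)
  obtain k where k: "(w, y) \<in> walk (\<Gamma> k) S"
    using Cons.IH[OF w] by blast
  define m where "m = max i (max j k)"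
  have le: "\<Gamma> i \<subseteq> \<Gamma> m" "\<Gamma> j \<subseteq> \<Gamma> m" "\<Gamma> k \<subseteq> \<Gamma> m"
    by (simp_all add: m_def incseqD[OF assms(1)])
  have "(x, z) \<in> eq_closure (\<Gamma> m)" "(z, w) \<in> role_edges (\<Gamma> m) r" "(w, y) \<in> walk (\<Gamma> m) S"
    using i j k eq_closure_mono[OF le(1)] le(2) walk_mono[OF le(3)]
    by (auto simp: role_edges_def)
  then show ?case by auto
qed

lemma chain_reaches:
  assumes "incseq \<Gamma>" "reaches (\<Union>n. \<Gamma> n) x L y"
  shows "\<exists>n. reaches (\<Gamma> n) x L y"
  using assms(2) chain_walk[OF assms(1)] unfolding reaches_iff by blast

subsection \<open>Role languages\<close>

lemma rewrite_context:
  "rewrite R S S' \<Longrightarrow> rewrite R (u @ S @ v) (u @ S' @ v)"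
proof -
  assume "rewrite R S S'"
  then obtain u' t v' T where "(t, T) \<in> productions R" "S = u' @ [t] @ v'" "S' = u' @ T @ v'"
    unfolding rewrite_def by blast
  then show ?thesis
    unfolding rewrite_def
    by (intro exI[of _ "u @ u'"] exI[of _ t] exI[of _ "v' @ v"] exI[of _ T]) simp
qed

lemma rewrites_context:
  "(rewrite R)\<^sup>*\<^sup>* S S' \<Longrightarrow> (rewrite R)\<^sup>*\<^sup>* (u @ S @ v) (u @ S' @ v)"
proof (induction rule: rtranclp_induct)
  case (step y z)
  then show ?case
    using rewrite_context[OF step.hyps(2), of u v] by (blast intro: rtranclp.rtrancl_into_rtrancl)
qed simp

lemma rewrites_append:
  assumes "(rewrite R)\<^sup>*\<^sup>* S S'" "(rewrite R)\<^sup>*\<^sup>* T T'"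
  shows "(rewrite R)\<^sup>*\<^sup>* (S @ T) (S' @ T')"
  using rewrites_context[OF assms(1), of "[]" T] rewrites_context[OF assms(2), of S' "[]"]
  by simp

lemma productions_inverse:
  assumes "(t, T) \<in> productions R"
  shows "(inv_role t, rev (map inv_role T)) \<in> productions R"
proof -
  have "rev (map inv_role (rev (map inv_role w))) = w" for w :: "'a role list"
    by (simp add: rev_map comp_def)
  then show ?thesis
    using assms unfolding productions_def by force
qed

lemma rewrite_inverse:
  assumes "rewrite R S S'"
  shows "rewrite R (rev (map inv_role S)) (rev (map inv_role S'))"
proof -
  obtain u t v T where "(t, T) \<in> productions R" and S: "S = u @ [t] @ v" "S' = u @ T @ v"
    using assms by (auto simp: rewrite_def)
  then have "(inv_role t, rev (map inv_role T)) \<in> productions R"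
    by (simp add: productions_inverse)
  then show ?thesis
    unfolding rewrite_def
    by (intro exI[of _ "rev (map inv_role v)"] exI[of _ "inv_role t"]
        exI[of _ "rev (map inv_role u)"] exI[of _ "rev (map inv_role T)"]) (simp add: S)
qed

text \<open>Productions come in mirrored pairs, so a derivation can be mirrored step by
  step.\<close>

lemma role_lang_inverse:
  assumes "S \<in> role_lang Ont r"
  shows "rev (map inv_role S) \<in> role_lang Ont (inv_role r)"
proof -
  have "(rewrite (rbox Ont))\<^sup>*\<^sup>* [r] S"
    using assms by (simp add: role_lang_def)
  then have "(rewrite (rbox Ont))\<^sup>*\<^sup>* (rev (map inv_role [r])) (rev (map inv_role S))"
  proof (induction rule: rtranclp_induct)
    case (step y z)
    then show ?case
      using rewrite_inverse[OF step.hyps(2)] by (blast intro: rtranclp.rtrancl_into_rtrancl)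
  qed simp
  then show ?thesis by (simp add: role_lang_def)
qed

lemma reaches_inverse:
  "reaches \<Gamma> x (role_lang Ont r) y \<Longrightarrow> reaches \<Gamma> y (role_lang Ont (inv_role r)) x"
  unfolding reaches_iff
  by (elim bexE) (rule bexI, erule walk_inverse, erule role_lang_inverse)

lemma reaches_edge: "RoleAt r x y \<in> \<Gamma> \<Longrightarrow> reaches \<Gamma> x (role_lang Ont r) y"
proof -
  assume "RoleAt r x y \<in> \<Gamma>"
  then have "(x, y) \<in> walk \<Gamma> [r]"
    using eq_closure_refl[of x \<Gamma>] eq_closure_refl[of y \<Gamma>]
    unfolding walk.simps role_edges_def by blast
  moreover have "[r] \<in> role_lang Ont r" by (simp add: role_lang_def)
  ultimately show ?thesis unfolding reaches_iff by blast
qed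

lemma reaches_eq_closure:
  assumes "(x', x) \<in> eq_closure \<Gamma>" "reaches \<Gamma> x L y" "(y, y') \<in> eq_closure \<Gamma>"
  shows "reaches \<Gamma> x' L y'"
proof -
  obtain S where "S \<in> L" "(x, y) \<in> walk \<Gamma> S" using assms(2) by (auto simp: reaches_iff)
  moreover have "(x', y') \<in> walk \<Gamma> S"
    using assms(1,3) calculation(2) eq_closure_O_walk[of \<Gamma> S] walk_O_eq_closure[of \<Gamma> S] by blast
  ultimately show ?thesis by (auto simp: reaches_iff)
qed

subsection \<open>Semantics of negation\<close>

lemma role_int_domain: "is_interp I \<Longrightarrow> role_int I r \<subseteq> domain I \<times> domain I"
  by (cases r) (auto simp: is_interp_def)

lemma sem_domain: "is_interp I \<Longrightarrow> sem I C \<subseteq> domain I"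
  by (induction C) (auto simp: is_interp_def)

text \<open>The complement is relative to the domain, so for \<open>Ex\<close> and
  \<open>All\<close> the successors must be known to lie in it. The clauses for infinite successor
  sets make the counting quantifiers exact complements.\<close>

lemma sem_dneg: "is_interp I \<Longrightarrow> sem I (dneg A\<^sub>0 C) = domain I - sem I C"
proof (induction C rule: dneg.induct)
  case (5 A\<^sub>0 r C)
  then show ?case using role_int_domain[of I r] by auto
next
  case (6 A\<^sub>0 r C)
  then show ?case using role_int_domain[of I r] by auto
qed (auto simp: bot_concept_def is_interp_def)

lemma is_concept_dneg: "is_concept R C \<Longrightarrow> is_concept R (dneg A\<^sub>0 C)"
  by (induction C rule: dneg.induct) (auto simp: bot_concept_def)

subsection \<open>Saturated sets and their interpretations\<close>

text \<open>The countermodel induction passes from \<open>AtMost n r C\<close> to the negation of \<open>C\<close>, which is not a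
  subconcept; negation does not increase this measure.\<close>

fun height :: "('c, 'r) concept \<Rightarrow> nat" where
  "height (Atom A) = 0"
| "height (NegAtom A) = 0"
| "height (Or C D) = Suc (max (height C) (height D))"
| "height (And C D) = Suc (max (height C) (height D))"
| "height (Ex r C) = Suc (height C)"
| "height (All r C) = Suc (height C)"
| "height (AtMost n s C) = Suc (height C)"
| "height (AtLeast n s C) = Suc (height C)"

lemma height_dneg: "height (dneg A\<^sub>0 C) \<le> height C"
  by (induction C rule: dneg.induct) (auto simp: bot_concept_def)

text \<open>Records what the premise of a rule contains after the principal formula has been
  deleted. Literals, \<open>Ex\<close> and \<open>AtLeast\<close> fall under the last clause because
  their rules keep the formula.\<close>

fun decomposed ::
  "'c \<Rightarrow> ('r, 'l) atom set \<Rightarrow> ('l \<times> ('c, 'r) concept) set \<Rightarrow> 'l \<Rightarrow> ('c, 'r) concept \<Rightarrow> bool"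
where
  "decomposed A\<^sub>0 \<Gamma> \<Theta> x (Or C D) \<longleftrightarrow> (x, C) \<in> \<Theta> \<and> (x, D) \<in> \<Theta>"
| "decomposed A\<^sub>0 \<Gamma> \<Theta> x (And C D) \<longleftrightarrow> (x, C) \<in> \<Theta> \<or> (x, D) \<in> \<Theta>"
| "decomposed A\<^sub>0 \<Gamma> \<Theta> x (All r C) \<longleftrightarrow> (\<exists>y. RoleAt r x y \<in> \<Gamma> \<and> (y, C) \<in> \<Theta>)"
| "decomposed A\<^sub>0 \<Gamma> \<Theta> x (AtMost n r C) \<longleftrightarrow>
     (\<exists>ys. length ys = Suc n \<and> all_distinct ys \<subseteq> \<Gamma> \<and> RoleAt r x ` set ys \<subseteq> \<Gamma> \<and>
       (\<forall>y \<in> set ys. (y, dneg A\<^sub>0 C) \<in> \<Theta>))"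
| "decomposed A\<^sub>0 \<Gamma> \<Theta> x C \<longleftrightarrow> False"

text \<open>The side condition of a rule that keeps its principal formula refers to the antecedent \<open>\<Gamma>\<close>
  of the conclusion, whereas \<open>\<Gamma>'\<close> and \<open>\<Theta>'\<close> belong to the premise. The labels \<open>ys\<close> are
  those the rule is applied to.\<close>

fun treated ::
  "'c \<Rightarrow> ('c, 'r) ontology \<Rightarrow> ('r, 'l) atom set \<Rightarrow> ('r, 'l) atom set \<Rightarrow>
   ('l \<times> ('c, 'r) concept) set \<Rightarrow> 'l list \<Rightarrow> 'l \<Rightarrow> ('c, 'r) concept \<Rightarrow> bool"
where
  "treated A\<^sub>0 Ont \<Gamma> \<Gamma>' \<Theta>' ys x (Atom A) \<longleftrightarrow>
     (\<forall>y. ys = [y] \<longrightarrow> (x, y) \<in> eq_closure \<Gamma> \<longrightarrow> (y, Atom A) \<in> \<Theta>')"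
| "treated A\<^sub>0 Ont \<Gamma> \<Gamma>' \<Theta>' ys x (NegAtom A) \<longleftrightarrow>
     (\<forall>y. ys = [y] \<longrightarrow> (x, y) \<in> eq_closure \<Gamma> \<longrightarrow> (y, NegAtom A) \<in> \<Theta>')"
| "treated A\<^sub>0 Ont \<Gamma> \<Gamma>' \<Theta>' ys x (Ex r C) \<longleftrightarrow>
     (\<forall>y. ys = [y] \<longrightarrow> reaches \<Gamma> x (role_lang Ont r) y \<longrightarrow> (y, C) \<in> \<Theta>')"
| "treated A\<^sub>0 Ont \<Gamma> \<Gamma>' \<Theta>' ys x (AtLeast n r C) \<longleftrightarrow>
     (length ys = n \<longrightarrow> (\<forall>y \<in> set ys. reaches \<Gamma> x (role_lang Ont r) y) \<longrightarrow>
       (\<exists>y \<in> set ys. (y, C) \<in> \<Theta>') \<or>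
       (\<exists>i j. i < j \<and> j < n \<and> EqAt (ys ! i) (ys ! j) \<in> \<Gamma>'))"
| "treated A\<^sub>0 Ont \<Gamma> \<Gamma>' \<Theta>' ys x C \<longleftrightarrow> decomposed A\<^sub>0 \<Gamma>' \<Theta>' x C"

lemma decomposed_mono:
  assumes "decomposed A\<^sub>0 \<Gamma> \<Theta> x C" "\<Gamma> \<subseteq> \<Gamma>'" "\<Theta> \<subseteq> \<Theta>'"
  shows "decomposed A\<^sub>0 \<Gamma>' \<Theta>' x C"
proof (cases C)
  case (AtMost n r D)
  then obtain ys where "length ys = Suc n" "all_distinct ys \<subseteq> \<Gamma>" "RoleAt r x ` set ys \<subseteq> \<Gamma>"
    "\<forall>y \<in> set ys. (y, dneg A\<^sub>0 D) \<in> \<Theta>"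
    using assms(1) by auto
  then have "length ys = Suc n \<and> all_distinct ys \<subseteq> \<Gamma>' \<and> RoleAt r x ` set ys \<subseteq> \<Gamma>' \<and>
    (\<forall>y \<in> set ys. (y, dneg A\<^sub>0 D) \<in> \<Theta>')"
    using assms(2,3) by blast
  then show ?thesis unfolding AtMost decomposed.simps by (rule exI)
next
  case (All r D)
  then obtain y where "RoleAt r x y \<in> \<Gamma>" "(y, D) \<in> \<Theta>"
    using assms(1) by auto
  then show ?thesis unfolding All decomposed.simps using assms(2,3) by blast
qed (use assms in auto)

lemma treated_mono:
  assumes "treated A\<^sub>0 Ont \<Gamma> \<Gamma>' \<Theta>' ys x C" "\<Gamma>' \<subseteq> \<Gamma>''" "\<Theta>' \<subseteq> \<Theta>''"
  shows "treated A\<^sub>0 Ont \<Gamma> \<Gamma>'' \<Theta>'' ys x C"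
proof (cases C)
  case (Atom A)
  show ?thesis using assms unfolding Atom treated.simps by blast
next
  case (NegAtom A)
  show ?thesis using assms unfolding NegAtom treated.simps by blast
next
  case (Ex r D)
  show ?thesis using assms unfolding Ex treated.simps by blast
next
  case (AtLeast n r D)
  show ?thesis using assms unfolding AtLeast treated.simps by blast
qed (use assms decomposed_mono[of A\<^sub>0 \<Gamma>' \<Theta>' x C \<Gamma>'' \<Theta>''] in simp_all)

text \<open>\<open>V\<close> may exceed the labels of \<open>\<Gamma>\<close>: with an empty
  antecedent the only label comes from the succedent. \<open>treated\<close> gets the same
  antecedent twice, since in the limit conclusions and premises merge into one set.\<close>

locale saturated =
  fixes A\<^sub>0 :: 'c and Ont :: "('c, 'r) ontology"
    and \<Gamma> :: "('r, 'l) atom set" and \<Theta> :: "('l \<times> ('c, 'r) concept) set"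
    and V :: "'l set" and h :: "'l \<Rightarrow> 'd"
  assumes h_eq_iff: "h x = h y \<longleftrightarrow> (x, y) \<in> eq_closure \<Gamma>"
    and V_nonempty: "V \<noteq> {}"
    and ant_labels_V: "ant_labels \<Gamma> \<subseteq> V"
    and Theta_V: "(x, C) \<in> \<Theta> \<Longrightarrow> x \<in> V"
    and no_clash: "(x, Atom A) \<in> \<Theta> \<Longrightarrow> (x, NegAtom A) \<notin> \<Theta>"
    and no_neq: "NeqAt x y \<in> \<Gamma> \<Longrightarrow> (x, y) \<notin> eq_closure \<Gamma>"
    and treated: "(x, C) \<in> \<Theta> \<Longrightarrow> treated A\<^sub>0 Ont \<Gamma> \<Gamma> \<Theta> ys x C"
    and tbox_V: "x \<in> V \<Longrightarrow> C \<in> tbox Ont \<Longrightarrow> (x, dneg A\<^sub>0 C) \<in> \<Theta>"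
begin

definition canon :: "('c, 'r, 'd) interp" where
  "canon = \<lparr>domain = h ` V,
     concept_int = (\<lambda>A. h ` {x \<in> V. (x, Atom A) \<notin> \<Theta>}),
     name_int = (\<lambda>r. {(h x, h y) | x y. x \<in> V \<and> y \<in> V \<and> reaches \<Gamma> x (role_lang Ont (Name r)) y})\<rparr>"

lemma canon_simps [simp]: "domain canon = h ` V"
  by (simp add: canon_def)

lemma is_interp_canon: "is_interp canon"
  using V_nonempty by (auto simp: is_interp_def canon_def)

text \<open>Independence of the representative comes from saturation under the substitution rule: an
  atom in \<open>\<Theta>\<close> at one label is in \<open>\<Theta>\<close> at every equal
  label.\<close>

lemma concept_int_canon:
  assumes "x \<in> V"
  shows "h x \<in> concept_int canon A \<longleftrightarrow> (x, Atom A) \<notin> \<Theta>"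
proof
  assume "h x \<in> concept_int canon A"
  then obtain y where y: "h x = h y" "(y, Atom A) \<notin> \<Theta>"
    by (auto simp: canon_def)
  then have "(x, y) \<in> eq_closure \<Gamma>" by (simp add: h_eq_iff)
  then show "(x, Atom A) \<notin> \<Theta>"
    using treated[of x "Atom A" "[y]"] y by auto
qed (use assms in \<open>auto simp: canon_def\<close>)

lemma name_int_canon:
  assumes "x \<in> V" "y \<in> V"
  shows "(h x, h y) \<in> name_int canon r \<longleftrightarrow> reaches \<Gamma> x (role_lang Ont (Name r)) y"
proof
  assume "(h x, h y) \<in> name_int canon r"
  then obtain x' y' where "h x = h x'" "h y = h y'" "reaches \<Gamma> x' (role_lang Ont (Name r)) y'"
    by (auto simp: canon_def)
  then show "reaches \<Gamma> x (role_lang Ont (Name r)) y"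
    using reaches_eq_closure h_eq_iff by metis
qed (use assms in \<open>auto simp: canon_def\<close>)

text \<open>\<open>canon\<close> fixes role names only. For an inverse role the walk is read
  backwards, and its string is mirrored into the language of the inverse.\<close>

lemma role_int_canon:
  assumes "x \<in> V" "y \<in> V"
  shows "(h x, h y) \<in> role_int canon r \<longleftrightarrow> reaches \<Gamma> x (role_lang Ont r) y"
proof (cases r)
  case (Name s)
  then show ?thesis using assms by (simp add: name_int_canon)
next
  case (Inverse s)
  then show ?thesis
    using assms reaches_inverse[of \<Gamma> x Ont "Inverse s" y] reaches_inverse[of \<Gamma> y Ont "Name s" x]
    by (auto simp: name_int_canon)
qed

text \<open>Each factor of the composition is witnessed by a walk whose string derives from that
  factor; the derivations run side by side and the walks concatenate.\<close>

lemma string_int_canon: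
  assumes "(h x, h y) \<in> string_int canon w" "x \<in> V" "y \<in> V"
  shows "\<exists>S. (rewrite (rbox Ont))\<^sup>*\<^sup>* w S \<and> (x, y) \<in> walk \<Gamma> S"
  using assms(1,2)
proof (induction w arbitrary: x)
  case Nil
  then have "(x, y) \<in> eq_closure \<Gamma>"
    by (auto simp: string_int_def h_eq_iff[symmetric])
  then show ?case by (intro exI[of _ "[]"]) simp
next
  case (Cons r w)
  then obtain d where d: "(h x, d) \<in> role_int canon r" "(d, h y) \<in> string_int canon w"
    by (auto simp: string_int_def)
  then obtain z where z: "d = h z" "z \<in> V"
    using role_int_domain[OF is_interp_canon, of r] by auto
  then obtain S where S: "S \<in> role_lang Ont r" "(x, z) \<in> walk \<Gamma> S"
    using d Cons.prems role_int_canon by (auto simp: reaches_iff)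
  obtain T where T: "(rewrite (rbox Ont))\<^sup>*\<^sup>* w T" "(z, y) \<in> walk \<Gamma> T"
    using Cons.IH d z by blast
  have "(rewrite (rbox Ont))\<^sup>*\<^sup>* (r # w) (S @ T)"
    using rewrites_append[of "rbox Ont" "[r]" S w T] S T by (simp add: role_lang_def)
  moreover have "(x, y) \<in> walk \<Gamma> (S @ T)"
    using S T by (auto simp: walk_append)
  ultimately show ?case by blast
qed

lemma string_int_domain: "string_int canon w \<subseteq> domain canon \<times> domain canon"
proof (induction w)
  case (Cons r w)
  then show ?case
    using role_int_domain[OF is_interp_canon, of r] by (auto simp: string_int_def)
qed (auto simp: string_int_def)

text \<open>The production from \<open>s\<close> to \<open>w\<close>, followed by a rewriting of
  \<open>w\<close> into \<open>S\<close>, rewrites \<open>[s]\<close> into \<open>S\<close>.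
  Interpreting roles by languages instead of single edges is what closes them under the
  inclusions.\<close>

lemma string_int_subset_role_int:
  assumes "(w, s) \<in> rbox Ont"
  shows "string_int canon w \<subseteq> role_int canon s"
proof
  fix p assume p: "p \<in> string_int canon w"
  then obtain x y where xy: "p = (h x, h y)" "x \<in> V" "y \<in> V"
    using string_int_domain[of w] by auto
  then obtain S where S: "(rewrite (rbox Ont))\<^sup>*\<^sup>* w S" "(x, y) \<in> walk \<Gamma> S"
    using string_int_canon p by blast
  have "rewrite (rbox Ont) [s] w"
    unfolding rewrite_def productions_def using assms
    by (intro exI[of _ "[]"] exI[of _ s] exI[of _ "[]"] exI[of _ w]) simp
  then have "S \<in> role_lang Ont s"
    using S(1) by (simp add: role_lang_def converse_rtranclp_into_rtranclp)
  then show "p \<in> role_int canon s"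
    using xy S(2) role_int_canon by (auto simp: reaches_iff)
qed

text \<open>Turns a lower bound on the successors into a list of labels from different classes, the
  form in which the rule for \<open>AtLeast\<close> takes its instances.\<close>

lemma at_least_witnesses:
  assumes "infinite A \<or> n \<le> card A" "A \<subseteq> h ` V"
  obtains ys where "length ys = n" "set ys \<subseteq> V" "h ` set ys \<subseteq> A" "distinct (map h ys)"
proof -
  obtain B where B: "B \<subseteq> A" "card B = n" "finite B"
    using assms(1) by (meson infinite_arbitrarily_large obtain_subset_with_card_n)
  then obtain ds where ds: "set ds = B" "distinct ds"
    using finite_distinct_list by blast
  have "\<forall>d \<in> B. \<exists>y. y \<in> V \<and> h y = d" using B(1) assms(2) by blast
  then obtain g where g: "\<And>d. d \<in> B \<Longrightarrow> g d \<in> V \<and> h (g d) = d" by metis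
  have "map h (map g ds) = ds"
    using g ds by (auto intro: map_idI)
  moreover have "length (map g ds) = n"
    using distinct_card[OF ds(2)] ds(1) B(2) by simp
  ultimately show ?thesis
    by (intro that[of "map g ds"]) (use ds g B in auto)
qed

text \<open>Membership in a role of \<open>canon\<close> is exactly the side condition of the rules
  for \<open>Ex\<close> and \<open>AtLeast\<close>. So saturation speaks about all successors of
  \<open>h x\<close>, including those due to role inclusions, inverses and equalities, not merely
  about the created leaves.\<close>

lemma falsified: "(x, C) \<in> \<Theta> \<Longrightarrow> h x \<notin> sem canon C"
proof (induction "height C" arbitrary: x C rule: less_induct)
  case less
  have IH: "h y \<notin> sem canon D" if "height D < height C" "(y, D) \<in> \<Theta>" for y D
    using less.hyps that by blast
  have xV: "x \<in> V" using Theta_V less.prems by blast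
  have rep: "\<exists>y \<in> V. e = h y" if "(h x, e) \<in> role_int canon r" for e r
    using that role_int_domain[OF is_interp_canon, of r] by auto
  show ?case
  proof (cases C)
    case (Atom A)
    then show ?thesis using less.prems xV concept_int_canon by simp
  next
    case (NegAtom A)
    then show ?thesis
      using less.prems xV concept_int_canon no_clash by auto
  next
    case (Or D E)
    \<comment> \<open>For a concept whose rule deletes the principal formula, \<open>treated\<close>
      ignores its list argument; \<open>[]\<close> is a dummy.\<close>
    then have "(x, D) \<in> \<Theta>" "(x, E) \<in> \<Theta>" using treated[OF less.prems, of "[]"] by simp_all
    moreover have "height D < height C" "height E < height C" using Or by simp_all
    ultimately show ?thesis using IH Or by simp
  next
    case (And D E)
    then have "(x, D) \<in> \<Theta> \<or> (x, E) \<in> \<Theta>" using treated[OF less.prems, of "[]"] by simp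
    moreover have "height D < height C" "height E < height C" using And by simp_all
    ultimately show ?thesis using IH And by auto
  next
    case (Ex r D)
    have "e \<notin> sem canon D" if e: "(h x, e) \<in> role_int canon r" for e
    proof -
      obtain y where y: "y \<in> V" "e = h y" using rep e by blast
      then have "reaches \<Gamma> x (role_lang Ont r) y" using e xV role_int_canon by simp
      then have "(y, D) \<in> \<Theta>" using treated[OF less.prems, of "[y]"] Ex by simp
      then show ?thesis using IH[of D y] Ex y by simp
    qed
    then show ?thesis using Ex by auto
  next
    case (All r D)
    then obtain y where y: "RoleAt r x y \<in> \<Gamma>" "(y, D) \<in> \<Theta>"
      using treated[OF less.prems, of "[]"] by auto
    then have "(h x, h y) \<in> role_int canon r"
      using role_int_canon[OF xV Theta_V[OF y(2)]] reaches_edge[OF y(1)] by blast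
    moreover have "h y \<notin> sem canon D" using IH[of D y] All y by simp
    ultimately show ?thesis using All by auto
  next
    case (AtMost n r D)
    then obtain ys where ys: "length ys = Suc n" "all_distinct ys \<subseteq> \<Gamma>" "RoleAt r x ` set ys \<subseteq> \<Gamma>"
      "\<forall>y \<in> set ys. (y, dneg A\<^sub>0 D) \<in> \<Theta>"
      using treated[OF less.prems, of "[]"] by auto
    let ?E = "{e. (h x, e) \<in> role_int canon r \<and> e \<in> sem canon D}"
    have neq: "h (ys ! i) \<noteq> h (ys ! j)" if "i < j" "j < length ys" for i j
    proof -
      have "NeqAt (ys ! i) (ys ! j) \<in> \<Gamma>"
        using that ys(2) unfolding all_distinct_def by blast
      then show ?thesis using no_neq h_eq_iff by blast
    qed
    \<comment> \<open>The inequality atoms cover only positions \<open>i < j\<close>, so the two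
      orders of a pair are treated separately. The result is \<open>n + 1\<close> different
      successors, one too many.\<close>
    have "distinct (map h ys)"
      unfolding distinct_conv_nth
    proof (intro allI impI)
      fix i j assume "i < length (map h ys)" "j < length (map h ys)" "i \<noteq> j"
      then show "map h ys ! i \<noteq> map h ys ! j"
        using neq[of i j] neq[of j i] by (cases "i < j") auto
    qed
    then have card: "card (h ` set ys) = Suc n"
      using ys(1) distinct_card[of "map h ys"] by simp
    have sub: "h ` set ys \<subseteq> ?E"
    proof (safe)
      fix y assume y: "y \<in> set ys"
      then have yD: "(y, dneg A\<^sub>0 D) \<in> \<Theta>" "RoleAt r x y \<in> \<Gamma>" using ys by auto
      then show "(h x, h y) \<in> role_int canon r"
        using role_int_canon[OF xV Theta_V[OF yD(1)]] reaches_edge[OF yD(2)] by blast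
      \<comment> \<open>\<open>\<Theta>\<close> contains the negation of \<open>D\<close>; its
        falsity at \<open>h y\<close> means truth of \<open>D\<close> because \<open>h y\<close>
        lies in the domain.\<close>
      have "height (dneg A\<^sub>0 D) < height C"
        using height_dneg[of A\<^sub>0 D] AtMost by simp
      then have "h y \<notin> sem canon (dneg A\<^sub>0 D)" using IH yD(1) by blast
      then show "h y \<in> sem canon D"
        using Theta_V[OF yD(1)] by (simp add: sem_dneg[OF is_interp_canon])
    qed
    have "Suc n \<le> card ?E" if "finite ?E" using card_mono[OF that sub] card by simp
    then show ?thesis using AtMost by auto
  next
    case (AtLeast n r D)
    let ?E = "{e. (h x, e) \<in> role_int canon r \<and> e \<in> sem canon D}"
    show ?thesis
    proof
      assume "h x \<in> sem canon C"
      then have "infinite ?E \<or> n \<le> card ?E" using AtLeast by simp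
      moreover have "?E \<subseteq> h ` V" using sem_domain[OF is_interp_canon] by auto
      ultimately obtain ys where ys: "length ys = n" "set ys \<subseteq> V" "h ` set ys \<subseteq> ?E"
        "distinct (map h ys)"
        by (rule at_least_witnesses)
      have reach: "reaches \<Gamma> x (role_lang Ont r) y" and sem: "h y \<in> sem canon D" if "y \<in> set ys" for y
        using that ys(2,3) xV role_int_canon[of x y r] by auto
      \<comment> \<open>Saturation is applied to the very labels that would witness the quantifier.
        For \<open>n = 0\<close> the list is empty and neither alternative can hold, in agreement
        with the rule having no premises then.\<close>
      from treated[OF less.prems, of ys] reach ys(1)
      consider y where "y \<in> set ys" "(y, D) \<in> \<Theta>"
        | i j where "i < j" "j < n" "EqAt (ys ! i) (ys ! j) \<in> \<Gamma>"
        unfolding AtLeast by auto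
      then show False
      proof cases
        case 1
        then show ?thesis using IH[of D y] AtLeast sem by simp
      next
        case 2
        then have "(ys ! i, ys ! j) \<in> eq_closure \<Gamma>"
          unfolding eq_closure_def by (intro r_into_rtrancl) simp
        then have "map h ys ! i = map h ys ! j" using 2 ys(1) by (simp add: h_eq_iff)
        then show ?thesis
          using ys(1,4) 2 nth_eq_iff_index_eq[of "map h ys" i j] by simp
      qed
    qed
  qed
qed

lemma models_canon: "models A\<^sub>0 canon Ont"
proof -
  have "h x \<in> sem canon C" if "x \<in> V" "C \<in> tbox Ont" for x C
    using falsified[OF tbox_V[OF that]] that(1) by (auto simp: sem_dneg[OF is_interp_canon])
  moreover have "sem canon (top_concept A\<^sub>0) \<subseteq> h ` V"
    using sem_domain[OF is_interp_canon] by auto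
  ultimately show ?thesis
    unfolding models_def using string_int_subset_role_int by blast
qed

end

subsection \<open>Fair saturation\<close>

lemma directed_tree_add_leaves:
  assumes "directed_tree V E" "x \<in> V" "Y \<inter> V = {}"
  shows "directed_tree (V \<union> Y) (E \<union> {x} \<times> Y)"
proof -
  from assms(1) obtain root where E: "E \<subseteq> V \<times> V" and root: "root \<in> V" "\<forall>u. (u, root) \<notin> E"
    and pred: "\<forall>v \<in> V - {root}. \<exists>!u. (u, v) \<in> E" and reach: "\<forall>v \<in> V. (root, v) \<in> E\<^sup>*"
    unfolding directed_tree_def by blast
  let ?E = "E \<union> {x} \<times> Y"
  have old: "(u, v) \<in> ?E \<longleftrightarrow> (u, v) \<in> E" if "v \<in> V" for u v
    using that assms(3) by blast
  have new: "(u, v) \<in> ?E \<longleftrightarrow> u = x" if "v \<in> Y" for u v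
    using that assms(3) E by blast
  have mono: "E\<^sup>* \<subseteq> ?E\<^sup>*" by (rule rtrancl_mono) simp
  have "?E \<subseteq> (V \<union> Y) \<times> (V \<union> Y)" using E assms(2) by blast
  moreover have "\<forall>u. (u, root) \<notin> ?E" using old[OF root(1)] root(2) by blast
  moreover have "\<exists>!u. (u, v) \<in> ?E" if "v \<in> V \<union> Y - {root}" for v
  proof (cases "v \<in> Y")
    case True
    then show ?thesis using new[OF True] by simp
  next
    case False
    then have "v \<in> V" "v \<in> V - {root}" using that by blast+
    then show ?thesis using old[of v] pred by simp
  qed
  moreover have "(root, v) \<in> ?E\<^sup>*" if "v \<in> V \<union> Y" for v
  proof (cases "v \<in> Y")
    case True
    then have "(x, v) \<in> ?E" by blast
    moreover have "(root, x) \<in> ?E\<^sup>*" using reach assms(2) mono by blast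
    ultimately show ?thesis by (rule rtrancl_into_rtrancl[rotated])
  next
    case False
    then show ?thesis using that reach mono by blast
  qed
  ultimately show ?thesis
    unfolding directed_tree_def using root(1) by (intro conjI bexI[of _ root]) auto
qed

definition role_pairs :: "('r, 'l) atom set \<Rightarrow> ('l \<times> 'l) set" where
  "role_pairs \<Gamma> = {(x, y). \<exists>r. RoleAt r x y \<in> \<Gamma>}"

lemma directed_tree_no_edges: "directed_tree V {} \<longleftrightarrow> (\<exists>x. V = {x})"
proof
  assume "directed_tree V {}"
  then obtain x where x: "x \<in> V" "\<And>v. v \<in> V \<Longrightarrow> (x, v) \<in> {}\<^sup>*"
    unfolding directed_tree_def by blast
  have "x = v" if "v \<in> V" for v using x(2)[OF that] by simp
  then show "\<exists>x. V = {x}" using x(1) by blast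
qed (auto simp: directed_tree_def)

lemma seq_labels_Sequent: "seq_labels (\<Gamma> \<turnstile> \<Delta>) = ant_labels \<Gamma> \<union> fst ` set_mset \<Delta>"
  by (simp add: seq_labels_def suc_labels_def)

text \<open>An edgeless tree is a single vertex, so a tree condition on all labels of the sequent
  covers the empty antecedent as well.\<close>

lemma is_sequent_iff:
  "is_sequent Ont (\<Gamma> \<turnstile> \<Delta>) \<longleftrightarrow>
     (\<forall>(x, C) \<in># \<Delta>. is_concept (rbox Ont) C) \<and>
     directed_tree (seq_labels (\<Gamma> \<turnstile> \<Delta>)) (role_pairs \<Gamma>) \<and>
     (\<Gamma> \<noteq> {} \<longrightarrow> suc_labels \<Delta> \<subseteq> ant_labels \<Gamma>)"
proof (cases "\<Gamma> = {}")
  case True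
  then have "ant_labels \<Gamma> = {}" "role_pairs \<Gamma> = {}"
    by (simp_all add: ant_labels_def role_pairs_def)
  then show ?thesis
    using True by (simp add: is_sequent_def seq_labels_def directed_tree_no_edges)
next
  case False
  have "ant_labels \<Gamma> \<union> suc_labels \<Delta> = ant_labels \<Gamma>" if "suc_labels \<Delta> \<subseteq> ant_labels \<Gamma>"
    using that by blast
  then show ?thesis
    using False by (auto simp: is_sequent_def seq_labels_def forms_tree_def role_pairs_def)
qed

lemma is_sequent_empty_ant:
  assumes "is_sequent Ont ({} \<turnstile> \<Delta>)" "x \<in> suc_labels \<Delta>"
  shows "suc_labels \<Delta> = {x}"
  using assms by (auto simp: is_sequent_def)

section \<open>Backward rule applications to unprovable sequents\<close>

definition open_sequent :: "'c \<Rightarrow> ('c, 'r) ontology \<Rightarrow> ('c, 'r, 'l) sequent \<Rightarrow> bool" where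
  "open_sequent A\<^sub>0 Ont S \<longleftrightarrow> is_sequent Ont S \<and> finite (ant S) \<and> \<not> provable A\<^sub>0 Ont S"

text \<open>What every backward step guarantees, whichever task it serves. It is kept apart from
  \<open>treated\<close>, which concerns the current task only, because persistence and the TBox
  negations have to be tracked through all steps.\<close>

definition progress ::
  "'c \<Rightarrow> ('c, 'r) ontology \<Rightarrow> ('c, 'r, 'l) sequent \<Rightarrow> ('c, 'r, 'l) sequent \<Rightarrow> bool" where
  "progress A\<^sub>0 Ont S S' \<longleftrightarrow> ant S \<subseteq> ant S' \<and>
     (\<forall>x C. (x, C) \<in># suc S \<longrightarrow>
        (x, C) \<in># suc S' \<or> decomposed A\<^sub>0 (ant S') (set_mset (suc S')) x C) \<and>
     (\<forall>y C. y \<in> seq_labels S' - seq_labels S \<longrightarrow> C \<in> tbox Ont \<longrightarrow> (y, dneg A\<^sub>0 C) \<in># suc S')"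

lemma progress_refl: "progress A\<^sub>0 Ont S S"
  by (simp add: progress_def)

text \<open>The reason for the finite antecedent in \<open>open_sequent\<close>: fresh labels can
  always be found.\<close>

lemma finite_seq_labels: "finite (ant S) \<Longrightarrow> finite (seq_labels S)"
proof -
  have "finite (atom_labels a)" for a :: "('a, 'b) atom" by (cases a) simp_all
  then show "finite (ant S) \<Longrightarrow> finite (seq_labels S)"
    by (simp add: seq_labels_def ant_labels_def suc_labels_def)
qed

text \<open>Covers the rule premises that leave the antecedent alone; \<open>M\<close> replaces the
  principal formula. With an empty antecedent, \<open>M \<noteq> {#}\<close> keeps a label in the
  succedent.\<close>

lemma progress_same_ant:
  assumes "open_sequent A\<^sub>0 Ont (\<Gamma> \<turnstile> {#(x, C)#} + \<Delta>)" "\<not> provable A\<^sub>0 Ont (\<Gamma> \<turnstile> M + \<Delta>)"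
    and "M \<noteq> {#}"
    and M: "\<And>y D. (y, D) \<in># M \<Longrightarrow>
      y \<in> insert x (ant_labels \<Gamma>) \<and> (is_concept (rbox Ont) C \<longrightarrow> is_concept (rbox Ont) D)"
    and "(x, C) \<in># M \<or> decomposed A\<^sub>0 \<Gamma> (set_mset (M + \<Delta>)) x C"
  shows "open_sequent A\<^sub>0 Ont (\<Gamma> \<turnstile> M + \<Delta>) \<and>
    progress A\<^sub>0 Ont (\<Gamma> \<turnstile> {#(x, C)#} + \<Delta>) (\<Gamma> \<turnstile> M + \<Delta>)"
proof -
  have seq: "is_sequent Ont (\<Gamma> \<turnstile> {#(x, C)#} + \<Delta>)" and fin: "finite \<Gamma>"
    using assms(1) by (simp_all add: open_sequent_def)
  have M_labels: "suc_labels M \<subseteq> insert x (ant_labels \<Gamma>)"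
    unfolding suc_labels_def using M by fastforce
  have labels: "suc_labels (M + \<Delta>) = suc_labels M \<union> suc_labels \<Delta>"
    "suc_labels ({#(x, C)#} + \<Delta>) = insert x (suc_labels \<Delta>)"
    by (auto simp: suc_labels_def)
  have C: "is_concept (rbox Ont) C" and \<Delta>: "\<And>y D. (y, D) \<in># \<Delta> \<Longrightarrow> is_concept (rbox Ont) D"
    using seq by (auto simp: is_sequent_def)
  have concepts: "\<forall>(y, D) \<in># M + \<Delta>. is_concept (rbox Ont) D"
    using M C \<Delta> by auto
  have "is_sequent Ont (\<Gamma> \<turnstile> M + \<Delta>)"
  proof (cases "\<Gamma> = {}")
    case True
    then have "insert x (suc_labels \<Delta>) = {x}"
      using is_sequent_empty_ant[of Ont _ x] seq labels(2) by auto
    moreover have "suc_labels M = {x}"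
    proof (rule subset_antisym)
      show "suc_labels M \<subseteq> {x}" using True M_labels by (simp add: ant_labels_def)
      then show "{x} \<subseteq> suc_labels M"
        using \<open>M \<noteq> {#}\<close> by (simp add: subset_singleton_iff) (simp add: suc_labels_def)
    qed
    ultimately have "suc_labels (M + \<Delta>) = {x}" using labels(1) by auto
    then show ?thesis using True concepts by (simp add: is_sequent_def)
  next
    case False
    then have "insert x (suc_labels \<Delta>) \<subseteq> ant_labels \<Gamma>" "forms_tree \<Gamma>"
      using seq labels(2) by (auto simp: is_sequent_def)
    then show ?thesis
      using False M_labels labels(1) concepts by (auto simp: is_sequent_def)
  qed
  moreover have "seq_labels (\<Gamma> \<turnstile> M + \<Delta>) \<subseteq> seq_labels (\<Gamma> \<turnstile> {#(x, C)#} + \<Delta>)"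
    using M_labels labels by (auto simp: seq_labels_def)
  ultimately show ?thesis
    using fin assms(2,5) by (auto simp: open_sequent_def progress_def)
qed

text \<open>Covers \<open>univ\<close> and \<open>at_most\<close> at once: \<open>Y\<close> holds
  the fresh labels, \<open>N\<close> the inequalities among them, \<open>D\<close> the concept
  placed at each. Freshness turns \<open>Y\<close> into leaves below \<open>x\<close>, and
  \<open>Y \<noteq> {}\<close> brings \<open>x\<close> into the antecedent if that was
  empty.\<close>

lemma progress_leaves:
  assumes "open_sequent A\<^sub>0 Ont (\<Gamma> \<turnstile> {#(x, C)#} + \<Delta>)" "\<not> provable A\<^sub>0 Ont (\<Gamma>' \<turnstile> \<Delta>')"
    and tbox: "\<forall>D \<in> tbox Ont. is_concept (rbox Ont) D"
    and Y: "Y \<noteq> {}" "finite Y" "Y \<inter> seq_labels (\<Gamma> \<turnstile> {#(x, C)#} + \<Delta>) = {}"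
    and \<Gamma>': "\<Gamma>' = \<Gamma> \<union> N \<union> RoleAt r x ` Y" and N: "N \<subseteq> case_prod NeqAt ` (Y \<times> Y)"
    and \<Delta>': "set_mset \<Delta>' = set_mset \<Delta> \<union> Y \<times> insert D (dneg A\<^sub>0 ` tbox Ont)"
    and D: "is_concept (rbox Ont) C \<longrightarrow> is_concept (rbox Ont) D"
    and dec: "decomposed A\<^sub>0 \<Gamma>' (set_mset \<Delta>') x C"
  shows "open_sequent A\<^sub>0 Ont (\<Gamma>' \<turnstile> \<Delta>') \<and>
    progress A\<^sub>0 Ont (\<Gamma> \<turnstile> {#(x, C)#} + \<Delta>) (\<Gamma>' \<turnstile> \<Delta>')"
proof -
  let ?S = "\<Gamma> \<turnstile> {#(x, C)#} + \<Delta>"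
  have seq: "is_sequent Ont ?S" and fin: "finite \<Gamma>"
    using assms(1) by (simp_all add: open_sequent_def)
  have "ant_labels N \<subseteq> Y"
    using N by (fastforce simp: ant_labels_def)
  moreover have "ant_labels (RoleAt r x ` Y) = insert x Y"
    using Y(1) by (auto simp: ant_labels_def)
  moreover have "ant_labels \<Gamma>' = ant_labels \<Gamma> \<union> ant_labels N \<union> ant_labels (RoleAt r x ` Y)"
    by (simp add: ant_labels_def \<Gamma>' Un_assoc)
  ultimately have ant: "ant_labels \<Gamma>' = ant_labels \<Gamma> \<union> insert x Y" by blast
  have suc: "suc_labels \<Delta>' = suc_labels \<Delta> \<union> Y"
    by (simp add: suc_labels_def \<Delta>' image_Un)
  have suc_S: "suc_labels ({#(x, C)#} + \<Delta>) = insert x (suc_labels \<Delta>)"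
    by (simp add: suc_labels_def)
  have labels: "seq_labels (\<Gamma>' \<turnstile> \<Delta>') = seq_labels ?S \<union> Y"
    using ant suc suc_S by (auto simp: seq_labels_def)
  have "role_pairs N = {}" using N by (auto simp: role_pairs_def)
  moreover have "role_pairs \<Gamma>' = role_pairs \<Gamma> \<union> role_pairs N \<union> role_pairs (RoleAt r x ` Y)"
    by (auto simp: role_pairs_def \<Gamma>')
  moreover have "role_pairs (RoleAt r x ` Y) = {x} \<times> Y" by (auto simp: role_pairs_def)
  ultimately have pairs: "role_pairs \<Gamma>' = role_pairs \<Gamma> \<union> {x} \<times> Y" by simp
  have "x \<in> seq_labels ?S" using suc_S by (simp add: seq_labels_def)
  then have "directed_tree (seq_labels (\<Gamma>' \<turnstile> \<Delta>')) (role_pairs \<Gamma>')"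
    unfolding labels pairs using seq Y(3)
    by (intro directed_tree_add_leaves) (simp_all add: is_sequent_iff)
  moreover have "suc_labels \<Delta>' \<subseteq> ant_labels \<Gamma>'"
  proof (cases "\<Gamma> = {}")
    case True
    then have "insert x (suc_labels \<Delta>) = {x}"
      using is_sequent_empty_ant[of Ont _ x] seq suc_S by auto
    then show ?thesis using suc ant by auto
  next
    case False
    then have "suc_labels \<Delta> \<subseteq> ant_labels \<Gamma>"
      using seq suc_S by (simp add: is_sequent_def)
    then show ?thesis using suc ant by auto
  qed
  moreover have "\<forall>(y, E) \<in># \<Delta>'. is_concept (rbox Ont) E"
    unfolding \<Delta>' using seq tbox D by (auto simp: is_sequent_def intro: is_concept_dneg)
  ultimately have "is_sequent Ont (\<Gamma>' \<turnstile> \<Delta>')" by (simp add: is_sequent_iff)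
  moreover have "finite N" using N by (rule finite_subset) (simp add: Y(2))
  moreover have "(y, dneg A\<^sub>0 E) \<in># \<Delta>'"
    if "y \<in> seq_labels (\<Gamma>' \<turnstile> \<Delta>') - seq_labels ?S" "E \<in> tbox Ont" for y E
    using that labels by (auto simp: \<Delta>')
  moreover have "(y, E) \<in># \<Delta>' \<or> decomposed A\<^sub>0 \<Gamma>' (set_mset \<Delta>') y E"
    if "(y, E) \<in># {#(x, C)#} + \<Delta>" for y E
    using that dec by (auto simp: \<Delta>')
  ultimately show ?thesis
    using fin assms(2) Y(2) by (auto simp: open_sequent_def progress_def \<Gamma>')
qed

text \<open>An equality atom adds no role edge, so the tree stays the same. If the antecedent was
  empty, \<open>a\<close> and \<open>b\<close> are both the single label of the succedent.\<close>

lemma progress_insert_eq: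
  assumes "open_sequent A\<^sub>0 Ont (\<Gamma> \<turnstile> \<Delta>)" "\<not> provable A\<^sub>0 Ont (insert (EqAt a b) \<Gamma> \<turnstile> \<Delta>)"
    and "a \<in> seq_labels (\<Gamma> \<turnstile> \<Delta>)" "b \<in> seq_labels (\<Gamma> \<turnstile> \<Delta>)"
  shows "open_sequent A\<^sub>0 Ont (insert (EqAt a b) \<Gamma> \<turnstile> \<Delta>) \<and>
    progress A\<^sub>0 Ont (\<Gamma> \<turnstile> \<Delta>) (insert (EqAt a b) \<Gamma> \<turnstile> \<Delta>)"
proof -
  have seq: "is_sequent Ont (\<Gamma> \<turnstile> \<Delta>)" and fin: "finite \<Gamma>"
    using assms(1) by (simp_all add: open_sequent_def)
  have ant: "ant_labels (insert (EqAt a b) \<Gamma>) = {a, b} \<union> ant_labels \<Gamma>"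
    by (simp add: ant_labels_def)
  then have labels: "seq_labels (insert (EqAt a b) \<Gamma> \<turnstile> \<Delta>) = seq_labels (\<Gamma> \<turnstile> \<Delta>)"
    using assms(3,4) by (auto simp: seq_labels_def)
  have pairs: "role_pairs (insert (EqAt a b) \<Gamma>) = role_pairs \<Gamma>"
    by (simp add: role_pairs_def)
  have "suc_labels \<Delta> \<subseteq> {a, b} \<union> ant_labels \<Gamma>"
  proof (cases "\<Gamma> = {}")
    case True
    then have "a \<in> suc_labels \<Delta>" using assms(3) by (simp add: seq_labels_def ant_labels_def)
    then have "suc_labels \<Delta> = {a}" using is_sequent_empty_ant[of Ont \<Delta> a] True seq by simp
    then show ?thesis by simp
  next
    case False
    then show ?thesis using seq by (auto simp: is_sequent_def)
  qed
  then have "is_sequent Ont (insert (EqAt a b) \<Gamma> \<turnstile> \<Delta>)"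
    using seq by (simp add: is_sequent_iff labels pairs ant)
  then show ?thesis
    using fin assms(2) labels by (auto simp: open_sequent_def progress_def)
qed

lemma fresh_list:
  fixes F :: "'l::infinite set"
  assumes "finite F"
  obtains ys where "length ys = n" "distinct ys" "set ys \<inter> F = {}"
proof -
  have "infinite (- F)" using assms by (simp add: infinite_UNIV Compl_eq_Diff_UNIV)
  then obtain B where B: "B \<subseteq> - F" "finite B" "card B = n"
    using infinite_arbitrarily_large by metis
  obtain ys where ys: "set ys = B" "distinct ys"
    using finite_distinct_list[OF B(2)] by blast
  show ?thesis
    by (rule that[of ys]) (use ys B distinct_card[OF ys(2)] in auto)
qed

lemma progress_literal:
  assumes "open_sequent A\<^sub>0 Ont (\<Gamma> \<turnstile> {#(x, L)#} + \<Delta>)" "literal L"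
  shows "\<exists>S'. open_sequent A\<^sub>0 Ont S' \<and> progress A\<^sub>0 Ont (\<Gamma> \<turnstile> {#(x, L)#} + \<Delta>) S' \<and>
    (\<forall>y. ys = [y] \<longrightarrow> (x, y) \<in> eq_closure \<Gamma> \<longrightarrow> (y, L) \<in># suc S')"
proof (cases "\<exists>y. ys = [y] \<and> (x, y) \<in> eq_closure \<Gamma>")
  case True
  then obtain y where y: "ys = [y]" "(x, y) \<in> eq_closure \<Gamma>" by blast
  let ?M = "{#(x, L), (y, L)#}"
  have "\<not> provable A\<^sub>0 Ont (\<Gamma> \<turnstile> ?M + \<Delta>)"
    using assms y(2) provable.subst_eq[of Ont \<Gamma> x L \<Delta> y A\<^sub>0] unfolding open_sequent_def by blast
  then have "open_sequent A\<^sub>0 Ont (\<Gamma> \<turnstile> ?M + \<Delta>) \<and>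
      progress A\<^sub>0 Ont (\<Gamma> \<turnstile> {#(x, L)#} + \<Delta>) (\<Gamma> \<turnstile> ?M + \<Delta>)"
    using eq_closure_labels[OF y(2)] by (intro progress_same_ant[OF assms(1)]) auto
  then show ?thesis using y(1) by (intro exI[of _ "\<Gamma> \<turnstile> ?M + \<Delta>"]) simp
next
  case False
  then show ?thesis
    using assms(1) by (intro exI[of _ "\<Gamma> \<turnstile> {#(x, L)#} + \<Delta>"]) (auto simp: progress_refl)
qed

text \<open>Read contrapositively, a rule with an unprovable conclusion has an unprovable premise,
  which serves as \<open>S'\<close>. If \<open>ys\<close> does not meet the side condition, the task
  is void and \<open>S\<close> itself is taken.\<close>

lemma exists_progress:
  fixes S :: "('c, 'r, 'l::infinite) sequent"
  assumes ont: "riq_ontology Ont" and S: "open_sequent A\<^sub>0 Ont S" "(x, C) \<in># suc S"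
  shows "\<exists>S'. open_sequent A\<^sub>0 Ont S' \<and> progress A\<^sub>0 Ont S S' \<and>
    treated A\<^sub>0 Ont (ant S) (ant S') (set_mset (suc S')) ys x C"
proof -
  obtain \<Gamma> \<Delta> where S_eq: "S = (\<Gamma> \<turnstile> {#(x, C)#} + \<Delta>)"
    using S(2) by (metis mset_add sequent.collapse add_mset_add_single add.commute)
  have op: "open_sequent A\<^sub>0 Ont (\<Gamma> \<turnstile> {#(x, C)#} + \<Delta>)" using S(1) S_eq by simp
  then have seq: "is_sequent Ont (\<Gamma> \<turnstile> {#(x, C)#} + \<Delta>)"
    and unprovable: "\<not> provable A\<^sub>0 Ont (\<Gamma> \<turnstile> {#(x, C)#} + \<Delta>)"
    and fin: "finite (seq_labels (\<Gamma> \<turnstile> {#(x, C)#} + \<Delta>))"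
    by (simp_all add: open_sequent_def finite_seq_labels)
  have tbox: "\<forall>D \<in> tbox Ont. is_concept (rbox Ont) D" "finite (tbox Ont)"
    using ont by (simp_all add: riq_ontology_def)
  have gci: "set_mset (gci A\<^sub>0 Ont y) = {y} \<times> dneg A\<^sub>0 ` tbox Ont" for y :: 'l
    using tbox(2) by (auto simp: gci_def)
  show ?thesis
  proof (cases C)
    case (Atom A)
    then show ?thesis
      using progress_literal[of A\<^sub>0 Ont \<Gamma> x C \<Delta> ys] op by (simp add: S_eq literal_def)
  next
    case (NegAtom A)
    then show ?thesis
      using progress_literal[of A\<^sub>0 Ont \<Gamma> x C \<Delta> ys] op by (simp add: S_eq literal_def)
  next
    case (Or D E)
    let ?M = "{#(x, D), (x, E)#}"
    have "\<not> provable A\<^sub>0 Ont (\<Gamma> \<turnstile> ?M + \<Delta>)"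
      using provable.disj[of Ont \<Gamma> x D E \<Delta> A\<^sub>0] seq unprovable Or by blast
    then have "open_sequent A\<^sub>0 Ont (\<Gamma> \<turnstile> ?M + \<Delta>) \<and>
        progress A\<^sub>0 Ont (\<Gamma> \<turnstile> {#(x, C)#} + \<Delta>) (\<Gamma> \<turnstile> ?M + \<Delta>)"
      by (intro progress_same_ant[OF op]) (auto simp: Or)
    then show ?thesis unfolding S_eq Or by (intro exI[of _ "\<Gamma> \<turnstile> ?M + \<Delta>"]) simp
  next
    case (And D E)
    then obtain F where F: "F = D \<or> F = E" "\<not> provable A\<^sub>0 Ont (\<Gamma> \<turnstile> {#(x, F)#} + \<Delta>)"
      using provable.conj[of Ont \<Gamma> x D E \<Delta> A\<^sub>0] seq unprovable by blast
    then have "open_sequent A\<^sub>0 Ont (\<Gamma> \<turnstile> {#(x, F)#} + \<Delta>) \<and>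
        progress A\<^sub>0 Ont (\<Gamma> \<turnstile> {#(x, C)#} + \<Delta>) (\<Gamma> \<turnstile> {#(x, F)#} + \<Delta>)"
      by (intro progress_same_ant[OF op]) (auto simp: And)
    then show ?thesis
      unfolding S_eq And using F(1) by (intro exI[of _ "\<Gamma> \<turnstile> {#(x, F)#} + \<Delta>"]) auto
  next
    case (Ex r D)
    show ?thesis
    proof (cases "\<exists>y. ys = [y] \<and> reaches \<Gamma> x (role_lang Ont r) y")
      case True
      then obtain y where y: "ys = [y]" "reaches \<Gamma> x (role_lang Ont r) y" by blast
      let ?M = "{#(x, Ex r D), (y, D)#}"
      have "\<not> provable A\<^sub>0 Ont (\<Gamma> \<turnstile> ?M + \<Delta>)"
        using provable.exist[of Ont \<Gamma> x r D \<Delta> y A\<^sub>0] y(2) seq unprovable Ex by blast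
      then have "open_sequent A\<^sub>0 Ont (\<Gamma> \<turnstile> ?M + \<Delta>) \<and>
          progress A\<^sub>0 Ont (\<Gamma> \<turnstile> {#(x, C)#} + \<Delta>) (\<Gamma> \<turnstile> ?M + \<Delta>)"
        using reaches_labels[OF y(2)] by (intro progress_same_ant[OF op]) (auto simp: Ex)
      then show ?thesis
        unfolding S_eq Ex using y(1) by (intro exI[of _ "\<Gamma> \<turnstile> ?M + \<Delta>"]) simp
    next
      case False
      then have "treated A\<^sub>0 Ont (ant S) (ant S) (set_mset (suc S)) ys x C"
        by (simp add: S_eq Ex)
      then show ?thesis using S(1) by (intro exI[of _ S]) (simp add: progress_refl)
    qed
  next
    case (All r D)
    obtain zs :: "'l list" where "length zs = 1" "set zs \<inter> seq_labels (\<Gamma> \<turnstile> {#(x, C)#} + \<Delta>) = {}"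
      using fresh_list[OF fin] by metis
    then obtain y where y: "y \<notin> seq_labels (\<Gamma> \<turnstile> {#(x, C)#} + \<Delta>)"
      by (cases zs) auto
    let ?\<Gamma> = "insert (RoleAt r x y) \<Gamma>" and ?\<Delta> = "{#(y, D)#} + gci A\<^sub>0 Ont y + \<Delta>"
    have "\<not> provable A\<^sub>0 Ont (?\<Gamma> \<turnstile> ?\<Delta>)"
      using provable.univ[of Ont \<Gamma> x r D \<Delta> y A\<^sub>0] y seq unprovable All by blast
    then have "open_sequent A\<^sub>0 Ont (?\<Gamma> \<turnstile> ?\<Delta>) \<and>
        progress A\<^sub>0 Ont (\<Gamma> \<turnstile> {#(x, C)#} + \<Delta>) (?\<Gamma> \<turnstile> ?\<Delta>)"
    proof (rule progress_leaves[OF op _ tbox(1), where Y = "{y}" and N = "{}" and D = D and r = r])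
      show "set_mset ?\<Delta> = set_mset \<Delta> \<union> {y} \<times> insert D (dneg A\<^sub>0 ` tbox Ont)"
        by (auto simp: gci)
    qed (use y in \<open>auto simp: All\<close>)
    then show ?thesis unfolding S_eq All by (intro exI[of _ "?\<Gamma> \<turnstile> ?\<Delta>"]) auto
  next
    case (AtMost n r D)
    obtain zs :: "'l list" where zs: "length zs = Suc n" "distinct zs"
      "set zs \<inter> seq_labels (\<Gamma> \<turnstile> {#(x, C)#} + \<Delta>) = {}"
      using fresh_list[OF fin] by metis
    let ?\<Gamma> = "\<Gamma> \<union> all_distinct zs \<union> RoleAt r x ` set zs"
      and ?\<Delta> = "(\<Sum>y \<in># mset zs. {#(y, dneg A\<^sub>0 D)#} + gci A\<^sub>0 Ont y) + \<Delta>"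
    have "\<not> provable A\<^sub>0 Ont (?\<Gamma> \<turnstile> ?\<Delta>)"
      using provable.at_most[of Ont \<Gamma> x n r D \<Delta> zs A\<^sub>0] zs seq unprovable AtMost by blast
    moreover have "set_mset ?\<Delta> = set_mset \<Delta> \<union> set zs \<times> insert (dneg A\<^sub>0 D) (dneg A\<^sub>0 ` tbox Ont)"
      by (auto simp: gci)
    moreover from this have "decomposed A\<^sub>0 ?\<Gamma> (set_mset ?\<Delta>) x C"
      unfolding AtMost decomposed.simps using zs(1) by (intro exI[of _ zs]) auto
    moreover have "all_distinct zs \<subseteq> case_prod NeqAt ` (set zs \<times> set zs)"
      by (force simp: all_distinct_def)
    ultimately have "open_sequent A\<^sub>0 Ont (?\<Gamma> \<turnstile> ?\<Delta>) \<and>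
        progress A\<^sub>0 Ont (\<Gamma> \<turnstile> {#(x, C)#} + \<Delta>) (?\<Gamma> \<turnstile> ?\<Delta>)"
      using zs
      by (intro progress_leaves[OF op _ tbox(1), where Y = "set zs" and N = "all_distinct zs" and
            D = "dneg A\<^sub>0 D" and r = r]) (auto simp: AtMost is_concept_dneg)
    then show ?thesis
      using \<open>decomposed A\<^sub>0 ?\<Gamma> (set_mset ?\<Delta>) x C\<close>
      unfolding S_eq AtMost by (intro exI[of _ "?\<Gamma> \<turnstile> ?\<Delta>"]) simp
  next
    case (AtLeast n r D)
    show ?thesis
    proof (cases "length ys = n \<and> (\<forall>y \<in> set ys. reaches \<Gamma> x (role_lang Ont r) y)")
      case True
      then have len: "length ys = n" and reach: "\<And>y. y \<in> set ys \<Longrightarrow> reaches \<Gamma> x (role_lang Ont r) y"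
        by simp_all
      consider y where "y \<in> set ys" "\<not> provable A\<^sub>0 Ont (\<Gamma> \<turnstile> {#(y, D), (x, AtLeast n r D)#} + \<Delta>)"
        | i j where "i < j" "j < n"
          "\<not> provable A\<^sub>0 Ont (insert (EqAt (ys ! i) (ys ! j)) \<Gamma> \<turnstile> {#(x, AtLeast n r D)#} + \<Delta>)"
        using provable.at_least[of Ont \<Gamma> x n r D \<Delta> ys A\<^sub>0] len reach seq unprovable AtLeast by blast
      then show ?thesis
      proof cases
        case 1
        let ?M = "{#(y, D), (x, AtLeast n r D)#}"
        have "open_sequent A\<^sub>0 Ont (\<Gamma> \<turnstile> ?M + \<Delta>) \<and>
            progress A\<^sub>0 Ont (\<Gamma> \<turnstile> {#(x, C)#} + \<Delta>) (\<Gamma> \<turnstile> ?M + \<Delta>)"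
          using reaches_labels[OF reach[OF 1(1)]] 1(2)
          by (intro progress_same_ant[OF op]) (auto simp: AtLeast)
        then show ?thesis
          unfolding S_eq AtLeast using 1(1) by (intro exI[of _ "\<Gamma> \<turnstile> ?M + \<Delta>"]) auto
      next
        case 2
        let ?\<Gamma> = "insert (EqAt (ys ! i) (ys ! j)) \<Gamma>"
        have "y \<in> seq_labels (\<Gamma> \<turnstile> {#(x, C)#} + \<Delta>)" if "y \<in> set ys" for y
          using reaches_labels[OF reach[OF that]] by (auto simp: seq_labels_Sequent)
        then have "open_sequent A\<^sub>0 Ont (?\<Gamma> \<turnstile> {#(x, C)#} + \<Delta>) \<and>
            progress A\<^sub>0 Ont (\<Gamma> \<turnstile> {#(x, C)#} + \<Delta>) (?\<Gamma> \<turnstile> {#(x, C)#} + \<Delta>)"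
          using 2 len by (intro progress_insert_eq[OF op]) (simp_all add: AtLeast)
        then show ?thesis
          unfolding S_eq AtLeast using 2 by (intro exI[of _ "?\<Gamma> \<turnstile> {#(x, AtLeast n r D)#} + \<Delta>"]) auto
      qed
    next
      case False
      then have "treated A\<^sub>0 Ont (ant S) (ant S) (set_mset (suc S)) ys x C"
        by (auto simp: S_eq AtLeast)
      then show ?thesis using S(1) by (intro exI[of _ S]) (simp add: progress_refl)
    qed
  qed
qed

section \<open>The limit of a fair run\<close>

locale fair_run =
  fixes A\<^sub>0 :: 'c and Ont :: "('c, 'r) ontology" and S :: "nat \<Rightarrow> ('c, 'r, 'l) sequent"
    and task :: "nat \<Rightarrow> ('l \<times> ('c, 'r) concept) \<times> 'l list"
  assumes open_run: "open_sequent A\<^sub>0 Ont (S n)"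
    and progress_run: "progress A\<^sub>0 Ont (S n) (S (Suc n))"
    and treated_run: "task n = ((x, C), ys) \<Longrightarrow> (x, C) \<in># suc (S n) \<Longrightarrow>
      treated A\<^sub>0 Ont (ant (S n)) (ant (S (Suc n))) (set_mset (suc (S (Suc n)))) ys x C"
    and fair: "\<exists>n \<ge> N. task n = t"
    and tbox_start: "y \<in> seq_labels (S 0) \<Longrightarrow> C \<in> tbox Ont \<Longrightarrow> (y, dneg A\<^sub>0 C) \<in># suc (S 0)"
begin

definition ant_lim :: "('r, 'l) atom set" where
  "ant_lim = (\<Union>n. ant (S n))"

definition suc_lim :: "('l \<times> ('c, 'r) concept) set" where
  "suc_lim = (\<Union>n. set_mset (suc (S n)))"

lemma incseq_ant: "incseq (\<lambda>n. ant (S n))"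
  using progress_run by (intro incseq_SucI) (simp add: progress_def)

lemma ant_le_lim: "ant (S n) \<subseteq> ant_lim"
  by (auto simp: ant_lim_def)

lemma suc_le_lim: "set_mset (suc (S n)) \<subseteq> suc_lim"
  by (auto simp: suc_lim_def)

lemma persists_or_decomposed:
  assumes "(x, C) \<in># suc (S n)" "n \<le> m"
  shows "(x, C) \<in># suc (S m) \<or> decomposed A\<^sub>0 ant_lim suc_lim x C"
  using assms(2)
proof (induction rule: dec_induct)
  case base
  then show ?case using assms(1) by simp
next
  case (step m)
  then show ?case
    using progress_run[of m] decomposed_mono[OF _ ant_le_lim suc_le_lim, of _ "Suc m" "Suc m"]
    unfolding progress_def by blast
qed

lemma literal_persists:
  assumes "(x, L) \<in># suc (S n)" "n \<le> m" "literal L"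
  shows "(x, L) \<in># suc (S m)"
  using persists_or_decomposed[OF assms(1,2)] assms(3) by (auto simp: literal_def)

text \<open>An undecomposed formula never leaves the succedent, so it is present when its task comes
  up again. The bound \<open>N\<close> lets that moment be so late that the side condition already
  holds.\<close>

lemma treated_late:
  assumes "(x, C) \<in> suc_lim" "\<not> decomposed A\<^sub>0 ant_lim suc_lim x C"
  shows "\<exists>n \<ge> N. treated A\<^sub>0 Ont (ant (S n)) ant_lim suc_lim ys x C"
proof -
  obtain m where m: "(x, C) \<in># suc (S m)" using assms(1) by (auto simp: suc_lim_def)
  obtain n where n: "n \<ge> max m N" "task n = ((x, C), ys)" using fair by blast
  have "(x, C) \<in># suc (S n)"
    using persists_or_decomposed[OF m, of n] assms(2) n(1) by simp
  then have "treated A\<^sub>0 Ont (ant (S n)) ant_lim suc_lim ys x C"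
    using treated_mono[OF treated_run[OF n(2)] ant_le_lim suc_le_lim] by blast
  then show ?thesis using n(1) by (intro exI[of _ n]) simp
qed

lemma reaches_lim_iff: "reaches ant_lim x L y \<longleftrightarrow> (\<exists>n. reaches (ant (S n)) x L y)"
proof
  assume "reaches ant_lim x L y"
  then show "\<exists>n. reaches (ant (S n)) x L y"
    unfolding ant_lim_def by (rule chain_reaches[OF incseq_ant])
next
  assume "\<exists>n. reaches (ant (S n)) x L y"
  then show "reaches ant_lim x L y"
    by (elim exE) (rule reaches_mono[OF ant_le_lim])
qed

text \<open>Only finitely many labels are listed and reachability is never lost, so a common stage
  exists.\<close>

lemma reaches_late: "\<forall>y \<in> set ys. reaches ant_lim x L y \<Longrightarrow>
    \<exists>N. \<forall>n \<ge> N. \<forall>y \<in> set ys. reaches (ant (S n)) x L y"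
proof (induction ys)
  case (Cons y ys)
  then obtain N k where N: "\<forall>n \<ge> N. \<forall>y \<in> set ys. reaches (ant (S n)) x L y"
    and k: "reaches (ant (S k)) x L y"
    by (auto simp: reaches_lim_iff)
  have "reaches (ant (S n)) x L y" if "n \<ge> k" for n
    using reaches_mono[OF incseqD[OF incseq_ant that] k] .
  then show ?case using N by (intro exI[of _ "max N k"]) simp
qed simp

lemma eq_closure_late:
  assumes "(x, y) \<in> eq_closure ant_lim"
  shows "\<exists>N. \<forall>n \<ge> N. (x, y) \<in> eq_closure (ant (S n))"
proof -
  obtain N where "(x, y) \<in> eq_closure (ant (S N))"
    using chain_eq_closure[OF incseq_ant] assms unfolding ant_lim_def by blast
  then show ?thesis
    using eq_closure_mono[OF incseqD[OF incseq_ant]] by blast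
qed

text \<open>The side condition now refers to the limit antecedent, whereas the rule was applied at a
  finite stage. The gap closes by choosing an application after the stage from which the condition
  holds. For concepts that get decomposed \<open>treated\<close> has no such condition, and the
  bound \<open>0\<close> suffices.\<close>

lemma treated_lim:
  assumes lim: "(x, C) \<in> suc_lim"
  shows "treated A\<^sub>0 Ont ant_lim ant_lim suc_lim ys x C"
proof (cases C)
  case (Atom A)
  have "(y, Atom A) \<in> suc_lim" if "ys = [y]" "(x, y) \<in> eq_closure ant_lim" for y
  proof -
    obtain N where N: "\<forall>n \<ge> N. (x, y) \<in> eq_closure (ant (S n))"
      using eq_closure_late[OF \<open>(x, y) \<in> eq_closure ant_lim\<close>] by blast
    obtain n where "n \<ge> N" "treated A\<^sub>0 Ont (ant (S n)) ant_lim suc_lim ys x (Atom A)"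
      using treated_late[OF lim, of N ys] unfolding Atom decomposed.simps by blast
    then show ?thesis using N that(1) Atom by simp
  qed
  then show ?thesis by (simp add: Atom)
next
  case (NegAtom A)
  have "(y, NegAtom A) \<in> suc_lim" if "ys = [y]" "(x, y) \<in> eq_closure ant_lim" for y
  proof -
    obtain N where N: "\<forall>n \<ge> N. (x, y) \<in> eq_closure (ant (S n))"
      using eq_closure_late[OF \<open>(x, y) \<in> eq_closure ant_lim\<close>] by blast
    obtain n where "n \<ge> N" "treated A\<^sub>0 Ont (ant (S n)) ant_lim suc_lim ys x (NegAtom A)"
      using treated_late[OF lim, of N ys] unfolding NegAtom decomposed.simps by blast
    then show ?thesis using N that(1) NegAtom by simp
  qed
  then show ?thesis by (simp add: NegAtom)
next
  case (Ex r D)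
  have "(y, D) \<in> suc_lim" if "ys = [y]" "reaches ant_lim x (role_lang Ont r) y" for y
  proof -
    have "\<forall>y \<in> set ys. reaches ant_lim x (role_lang Ont r) y" using that by simp
    then obtain N where N: "\<forall>n \<ge> N. \<forall>y \<in> set ys. reaches (ant (S n)) x (role_lang Ont r) y"
      using reaches_late by blast
    obtain n where "n \<ge> N" "treated A\<^sub>0 Ont (ant (S n)) ant_lim suc_lim ys x (Ex r D)"
      using treated_late[OF lim, of N ys] unfolding Ex decomposed.simps by blast
    then show ?thesis using N that(1) Ex by simp
  qed
  then show ?thesis by (simp add: Ex)
next
  case (AtLeast k r D)
  have "(\<exists>y \<in> set ys. (y, D) \<in> suc_lim) \<or> (\<exists>i j. i < j \<and> j < k \<and> EqAt (ys ! i) (ys ! j) \<in> ant_lim)"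
    if len: "length ys = k" and reach: "\<forall>y \<in> set ys. reaches ant_lim x (role_lang Ont r) y"
  proof -
    obtain N where N: "\<forall>n \<ge> N. \<forall>y \<in> set ys. reaches (ant (S n)) x (role_lang Ont r) y"
      using reaches_late[OF reach] by blast
    obtain n where "n \<ge> N" "treated A\<^sub>0 Ont (ant (S n)) ant_lim suc_lim ys x (AtLeast k r D)"
      using treated_late[OF lim, of N ys] unfolding AtLeast decomposed.simps by blast
    then show ?thesis using N len unfolding AtLeast treated.simps by blast
  qed
  then show ?thesis unfolding AtLeast treated.simps by blast
next
  case (AtMost k r D)
  then show ?thesis using treated_late[OF lim, of 0 ys] unfolding AtMost treated.simps by blast
qed (use treated_late[OF lim, of 0 ys] in auto)

lemma no_clash_lim:
  assumes "(x, Atom A) \<in> suc_lim"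
  shows "(x, NegAtom A) \<notin> suc_lim"
proof
  assume "(x, NegAtom A) \<in> suc_lim"
  then obtain n m where nm: "(x, Atom A) \<in># suc (S n)" "(x, NegAtom A) \<in># suc (S m)"
    using assms by (auto simp: suc_lim_def)
  \<comment> \<open>The literals may enter at different stages, but literals are never deleted; at
    the later stage both are present and the axiom \<open>id\<close> would apply.\<close>
  let ?S = "S (max n m)"
  have "(x, Atom A) \<in># suc ?S" "(x, NegAtom A) \<in># suc ?S"
    using literal_persists[OF nm(1), of "max n m"] literal_persists[OF nm(2), of "max n m"]
    by (simp_all add: literal_def)
  \<comment> \<open>The two pairs differ, so membership of each suffices for inclusion of
    multisets.\<close>
  then have "{#(x, Atom A), (x, NegAtom A)#} \<subseteq># suc ?S"
    by (simp add: insert_subset_eq_iff in_diff_count)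
  then obtain \<Delta> where \<Delta>: "suc ?S = {#(x, Atom A), (x, NegAtom A)#} + \<Delta>"
    by (rule mset_subset_eq_exists_conv[THEN iffD1, THEN exE])
  have S: "?S = (ant ?S \<turnstile> {#(x, Atom A), (x, NegAtom A)#} + \<Delta>)"
    by (rule sequent.expand) (simp add: \<Delta>)
  have "is_sequent Ont ?S" "\<not> provable A\<^sub>0 Ont ?S"
    using open_run[of "max n m"] by (simp_all add: open_sequent_def)
  then show False
    using provable.id[of Ont "ant ?S" x A \<Delta> A\<^sub>0] unfolding S[symmetric] by blast
qed

lemma no_neq_lim:
  assumes "NeqAt x y \<in> ant_lim"
  shows "(x, y) \<notin> eq_closure ant_lim"
proof
  assume "(x, y) \<in> eq_closure ant_lim"
  then obtain N where N: "\<forall>n \<ge> N. (x, y) \<in> eq_closure (ant (S n))"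
    using eq_closure_late by blast
  obtain n where n: "NeqAt x y \<in> ant (S n)" using assms by (auto simp: ant_lim_def)
  let ?S = "S (max n N)"
  have "NeqAt x y \<in> ant ?S" using n incseqD[OF incseq_ant, of n "max n N"] by auto
  then have ant: "insert (NeqAt x y) (ant ?S) = ant ?S" by (rule insert_absorb)
  have "provable A\<^sub>0 Ont (ant ?S \<turnstile> suc ?S)"
    using provable.id_eq[of Ont x y "ant ?S" "suc ?S" A\<^sub>0] N open_run[of "max n N"]
    by (simp add: ant open_sequent_def)
  then show False using open_run[of "max n N"] by (simp add: open_sequent_def)
qed

lemma tbox_lim:
  "y \<in> seq_labels (S n) \<Longrightarrow> C \<in> tbox Ont \<Longrightarrow> (y, dneg A\<^sub>0 C) \<in> suc_lim"
proof (induction n)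
  case 0
  then show ?case using tbox_start suc_le_lim by blast
next
  case (Suc n)
  show ?case
  proof (cases "y \<in> seq_labels (S n)")
    case True
    then show ?thesis using Suc by blast
  next
    case False
    then have "(y, dneg A\<^sub>0 C) \<in># suc (S (Suc n))"
      using Suc.prems progress_run[of n] unfolding progress_def by blast
    then show ?thesis using suc_le_lim by blast
  qed
qed

text \<open>Collecting the labels of whole sequents retains the label of the end sequent even if no
  atom is ever added. \<open>h\<close> is left open because its existence depends on the type
  \<open>'d\<close>.\<close>

lemma saturated_lim:
  assumes h: "\<And>x y. h x = h y \<longleftrightarrow> (x, y) \<in> eq_closure ant_lim"
  shows "saturated A\<^sub>0 Ont ant_lim suc_lim (\<Union>n. seq_labels (S n)) h"
proof
  show "(\<Union>n. seq_labels (S n)) \<noteq> {}"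
  proof -
    have "is_sequent Ont (ant (S 0) \<turnstile> suc (S 0))"
      using open_run[of 0] by (simp add: open_sequent_def)
    then have "directed_tree (seq_labels (S 0)) (role_pairs (ant (S 0)))"
      unfolding is_sequent_iff by simp
    then show ?thesis unfolding directed_tree_def by blast
  qed
  show "ant_labels ant_lim \<subseteq> (\<Union>n. seq_labels (S n))"
    by (auto simp: ant_lim_def ant_labels_def seq_labels_def)
  show "x \<in> (\<Union>n. seq_labels (S n))" if "(x, C) \<in> suc_lim" for x C
    using that by (force simp: suc_lim_def seq_labels_def suc_labels_def)
  show "(x, dneg A\<^sub>0 C) \<in> suc_lim" if "x \<in> (\<Union>n. seq_labels (S n))" "C \<in> tbox Ont" for x C
    using that tbox_lim by blast
qed (rule h no_clash_lim no_neq_lim treated_lim, assumption?)+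

end

section \<open>Existence of fair runs\<close>

lemma fair_tasks:
  obtains task :: "nat \<Rightarrow> 'a::countable" where "\<And>N t. \<exists>n \<ge> N. task n = t"
proof
  fix N and t :: 'a
  \<comment> \<open>The first component of the decoded pair selects the task, the second is padding.
    A pair code is at least its second component, so padding with \<open>N\<close> gives an index
    not below \<open>N\<close>.\<close>
  show "\<exists>n \<ge> N. from_nat (fst (prod_decode n)) = t"
    by (intro exI[of _ "prod_encode (to_nat t, N)"]) (simp add: le_prod_encode_2)
qed

lemma fair_run_exists:
  fixes A\<^sub>0 :: "'c::countable" and Ont :: "('c, 'r::countable) ontology"
    and S\<^sub>0 :: "('c, 'r, 'l::{countable, infinite}) sequent"
  assumes ont: "riq_ontology Ont" and "open_sequent A\<^sub>0 Ont S\<^sub>0"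
    and tbox: "\<And>y C. y \<in> seq_labels S\<^sub>0 \<Longrightarrow> C \<in> tbox Ont \<Longrightarrow> (y, dneg A\<^sub>0 C) \<in># suc S\<^sub>0"
  obtains S task where "S 0 = S\<^sub>0" "fair_run A\<^sub>0 Ont S task"
proof -
  obtain task :: "nat \<Rightarrow> ('l \<times> ('c, 'r) concept) \<times> 'l list"
    where task: "\<And>N t. \<exists>n \<ge> N. task n = t"
    using fair_tasks by blast
  define step where "step n S S' \<longleftrightarrow> progress A\<^sub>0 Ont S S' \<and>
    (\<forall>x C ys. task n = ((x, C), ys) \<longrightarrow> (x, C) \<in># suc S \<longrightarrow>
      treated A\<^sub>0 Ont (ant S) (ant S') (set_mset (suc S')) ys x C)" for n S S'
  have "\<exists>S'. open_sequent A\<^sub>0 Ont S' \<and> step n S S'" if op: "open_sequent A\<^sub>0 Ont S" for n S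
  proof -
    obtain x C ys where t: "task n = ((x, C), ys)" by (metis surj_pair)
    show ?thesis
    proof (cases "(x, C) \<in># suc S")
      case True
      then show ?thesis using exists_progress[OF ont op True, of ys] t by (auto simp: step_def)
    next
      case False
      then show ?thesis using op t by (intro exI[of _ S]) (simp add: step_def progress_refl)
    qed
  qed
  \<comment> \<open>Dependent choice does not prescribe the first element; the conjunct on
    \<open>n = 0\<close> pins it to \<open>S\<^sub>0\<close>.\<close>
  then obtain S where S: "\<And>n. (n = 0 \<longrightarrow> S n = S\<^sub>0) \<and> open_sequent A\<^sub>0 Ont (S n)" "\<And>n. step n (S n) (S (Suc n))"
    using dependent_nat_choice[of "\<lambda>n S. (n = 0 \<longrightarrow> S = S\<^sub>0) \<and> open_sequent A\<^sub>0 Ont S" step]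
      assms(2) by auto
  have "S 0 = S\<^sub>0" using S(1) by blast
  moreover have "fair_run A\<^sub>0 Ont S task"
    by standard (use S task tbox \<open>S 0 = S\<^sub>0\<close> in \<open>auto simp: step_def\<close>)
  ultimately show ?thesis by (rule that)
qed

theorem theorem2:
  fixes A\<^sub>0 :: "'c::countable"
    and Ont :: "('c, 'r::countable) ontology"
    and C :: "('c, 'r) concept"
    and x :: "'l::{countable, infinite}"
  assumes "riq_ontology Ont"
    and "is_concept (rbox Ont) C"
    and "valid TYPE('d::infinite) A\<^sub>0 Ont ({} \<turnstile> {#(x, C)#})"
  shows "provable A\<^sub>0 Ont ({} \<turnstile> gci A\<^sub>0 Ont x + {#(x, C)#})"
proof (rule ccontr)
  let ?S = "{} \<turnstile> gci A\<^sub>0 Ont x + {#(x, C)#}"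
  assume unprovable: "\<not> provable A\<^sub>0 Ont ?S"
  have tbox: "finite (tbox Ont)" "\<forall>D \<in> tbox Ont. is_concept (rbox Ont) D"
    using assms(1) by (simp_all add: riq_ontology_def)
  then have gci: "set_mset (gci A\<^sub>0 Ont x) = {x} \<times> dneg A\<^sub>0 ` tbox Ont"
    by (auto simp: gci_def)
  then have "suc_labels (suc ?S) = {x}" by (auto simp: suc_labels_def)
  then have labels: "seq_labels ?S = {x}" and "is_sequent Ont ?S"
    using assms(2) tbox(2) gci
    by (auto simp: seq_labels_def ant_labels_def is_sequent_def is_concept_dneg)
  then have "open_sequent A\<^sub>0 Ont ?S" using unprovable by (simp add: open_sequent_def)
  then obtain S task where S: "S 0 = ?S" and "fair_run A\<^sub>0 Ont S task"
    using fair_run_exists[OF assms(1), of A\<^sub>0 ?S] labels gci by auto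
  then interpret fair_run A\<^sub>0 Ont S task by simp
  \<comment> \<open>As \<open>'d\<close> is only known to be infinite, each class is represented by
    one chosen label whose code is embedded through \<open>nat\<close>. Equal labels have the same
    class as a set, hence the same chosen label.\<close>
  obtain g :: "nat \<Rightarrow> 'd" where g: "inj g"
    using infinite_countable_subset[OF infinite_UNIV] by blast
  define h where "h y = g (to_nat (SOME z. z \<in> eq_class ant_lim y))" for y
  have "(SOME z. z \<in> eq_class ant_lim y) \<in> eq_class ant_lim y" for y
    by (rule someI[of _ y]) (simp add: eq_class_def)
  then have class_rep: "eq_class ant_lim (SOME z. z \<in> eq_class ant_lim y) = eq_class ant_lim y" for y
    by (metis eq_class_eq_iff eq_class_def mem_Collect_eq)
  have h: "h y = h z \<longleftrightarrow> (y, z) \<in> eq_closure ant_lim" for y z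
  proof
    assume "h y = h z"
    then have rep: "(SOME u. u \<in> eq_class ant_lim y) = (SOME u. u \<in> eq_class ant_lim z)"
      by (simp add: h_def inj_eq[OF g])
    have "eq_class ant_lim y = eq_class ant_lim z"
      using class_rep[of y] class_rep[of z] unfolding rep by (rule trans[OF sym])
    then show "(y, z) \<in> eq_closure ant_lim" by (simp only: eq_class_eq_iff)
  next
    assume "(y, z) \<in> eq_closure ant_lim"
    then have "eq_class ant_lim y = eq_class ant_lim z" by (simp add: eq_class_eq_iff)
    then show "h y = h z" by (simp add: h_def)
  qed
  interpret saturated A\<^sub>0 Ont ant_lim suc_lim "\<Union>n. seq_labels (S n)" h
    using h by (rule saturated_lim)
  have x: "(x, C) \<in> suc_lim" using suc_le_lim[of 0] S by auto
  have "h x \<in> domain canon" using Theta_V[OF x] by simp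
  \<comment> \<open>The assignment is constant because \<open>valid\<close> wants every label sent
    into the domain, which \<open>h\<close> guarantees only for labels of the run. The empty
    antecedent imposes nothing.\<close>
  then have "\<exists>(y, D) \<in># suc ({} \<turnstile> {#(x, C)#}). h x \<in> sem canon D"
    using assms(3) is_interp_canon models_canon unfolding valid_def
    by (elim allE[of _ canon] allE[of _ "\<lambda>_. h x"]) auto
  then show False using falsified[OF x] by simp
qed

end
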